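(* There exists a constant $C>0$ depending only on $p$ such that for all $w,z\in V_h$, setting $e=w-z$, $$\sum_{E\in\Omega_h}\big[s_E(w,e)-s_E(z,e)\big]\;\ge\; C\left[\sum_{E\in\Omega_h}\big[s_E(w,w)+s_E(z,z)\big]\right]^{\frac{\underline{p}'-2}{p'}}\left[\sum_{E\in\Omega_h}s_E(e,e)\right]^{\frac{\overline{p}'}{p'}},$$ where $\underline{p}'=\min\{p',2\}$ and $\overline{p}'=\max\{p',2\}$ (a factor with exponent $0$ is read as $1$, and the right-hand side is read as $0$ if $w=z=0$).
   Context: Setting. $\Omega\subset\mathbb R^2$ is an open, bounded, connected polygonal domain with Lipschitz boundary; $p\in(1,\infty)$ and the integer $k\ge0$ are fixed; $p'=p/(p-1)$. $\Omega_h$ (a member of a family of meshes) is a decomposition of $\Omega$ into nonoverlapping polygonal elements $E$; $h_E$, $|E|$, $x_E$, $\mathcal E_E$ are the diameter, area, barycenter and set of edges of $E$; $h_e$, $x_e$, $n_e$ are the length, midpoint and a fixed unit normal of an edge $e$. Mesh regularity: there is $\rho>0$ (uniform over the family) such that every $E$ is star-shaped with respect to a disk of radius $\ge\rho h_E$ and $h_e\ge\rho h_E$ for all $e\in\mathcal E_E$. $\mathcal P^\ell(Y)$: polynomials of total degree $\le\ell$ on $Y$ ($\mathcal P^{-1}=\{0\}$). $\operatorname{rot}w=\partial_1w_2-\partial_2w_1$; $(a_1,a_2)^\perp=(-a_2,a_1)$. Spaces. $V_h(E)=\{v\in H(\mathrm{div};E)\cap H(\mathrm{rot};E): v\cdot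 n_e\in\mathcal P^k(e)\ \forall e\in\mathcal E_E,\ \nabla\cdot v\in\mathcal P^k(E),\ \operatorname{rot}v\in\mathcal P^{k-1}(E)\}$. $\mathrm{dof}_E(v)\in\mathbb R^{N_E}$, $N_E=\dim V_h(E)$, is the vector of degrees of freedom (which determine $v\in V_h(E)$ uniquely): (i) $\frac1{h_e}\int_e (v\cdot n_e)m$ for each $e\in\mathcal E_E$, $m=((x-x_e)/h_e)^\alpha$, $0\le\alpha\le k$ ($x$ a length coordinate on $e$); (ii) $\frac{h_E}{|E|}\int_E v\cdot\nabla m$, $m=((x-x_E)/h_E)^{\alpha}$, $1\le|\alpha|\le k$; (iii) $\frac1{|E|}\int_E v\cdot\left(\frac{x-x_E}{h_E}\right)^\perp m$, $m=((x-x_E)/h_E)^{\alpha}$, $|\alpha|\le k-1$. $V_h=\{v\in H(\mathrm{div};\Omega): v|_E\in V_h(E)\ \forall E\in\Omega_h\}$. Stabilization. $s_E(w,v)=h_E^2|\mathrm{dof}_E(w|_E)|^{p'-2}\mathrm{dof}_E(w|_E)\cdot\mathrm{dof}_E(v|_E)$, with $|\cdot|$ the Euclidean norm and $|A|^{p'-2}A:=0$ at $A=0$. *)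

theory Defs
  imports "HOL-Analysis.Analysis"
begin

type_synonym plane = "real^2"

definition perp :: "plane \<Rightarrow> plane" where
  "perp a = vector [- (a $ 2), a $ 1]"

definition conj_exp :: "real \<Rightarrow> real" where
  "conj_exp p = p / (p - 1)"

text \<open>The real power with the convention that exponent 0 gives 1, whatever the base
  (whereas \<open>0 powr 0 = 0\<close>). For a nonzero exponent, base 0 gives 0 also when the
  exponent is negative.\<close>

definition rpow :: "real \<Rightarrow> real \<Rightarrow> real" where
  "rpow x a = (if a = 0 then 1 else x powr a)"


subsection \<open>Polynomials\<close>

text \<open>The degree bound is an integer, so that the polynomials of degree at most -1 are
  the zero function. An edge is a subset of the plane: restricting plane polynomials
  to it gives the univariate polynomials in the length coordinate.\<close>

definition multi_indices :: "int \<Rightarrow> (nat \<times> nat) set" where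
  "multi_indices l = {\<alpha>. int (fst \<alpha> + snd \<alpha>) \<le> l}"

definition polys :: "int \<Rightarrow> plane set \<Rightarrow> (plane \<Rightarrow> real) set" where
  "polys l Y = {f. \<exists>c. \<forall>x\<in>Y. f x = (\<Sum>\<alpha>\<in>multi_indices l. c \<alpha> * (x $ 1) ^ fst \<alpha> * (x $ 2) ^ snd \<alpha>)}"


subsection \<open>Test functions, weak divergence and weak rotation\<close>

definition grad :: "(plane \<Rightarrow> real) \<Rightarrow> plane \<Rightarrow> plane" where
  "grad f x = (\<chi> i. frechet_derivative f (at x) (axis i 1))"

primrec C_n :: "nat \<Rightarrow> (plane \<Rightarrow> real) \<Rightarrow> bool" where
  "C_n 0 f \<longleftrightarrow> continuous_on UNIV f"
| "C_n (Suc n) f \<longleftrightarrow> (\<forall>x. f differentiable (at x)) \<and> (\<forall>i. C_n n (\<lambda>x. grad f x $ i))"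

definition smooth :: "(plane \<Rightarrow> real) \<Rightarrow> bool" where
  "smooth f \<longleftrightarrow> (\<forall>n. C_n n f)"

definition test_functions :: "plane set \<Rightarrow> (plane \<Rightarrow> real) set" where
  "test_functions U = {\<phi>. smooth \<phi> \<and> compact (closure {x. \<phi> x \<noteq> 0}) \<and> closure {x. \<phi> x \<noteq> 0} \<subseteq> U}"

definition L2 :: "plane set \<Rightarrow> (plane \<Rightarrow> 'b::euclidean_space) \<Rightarrow> bool" where
  "L2 U f \<longleftrightarrow> f \<in> borel_measurable (lebesgue_on U) \<and> integrable (lebesgue_on U) (\<lambda>x. (norm (f x))\<^sup>2)"

definition weak_div :: "plane set \<Rightarrow> (plane \<Rightarrow> plane) \<Rightarrow> (plane \<Rightarrow> real) \<Rightarrow> bool" where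
  "weak_div U v d \<longleftrightarrow> L2 U v \<and> L2 U d \<and>
     (\<forall>\<phi>\<in>test_functions U.
        (LINT x|lebesgue_on U. v x \<bullet> grad \<phi> x) = - (LINT x|lebesgue_on U. d x * \<phi> x))"

text \<open>Note that \<open>v \<bullet> perp (grad \<phi>) = v\<^sub>2 \<partial>\<^sub>1\<phi> - v\<^sub>1 \<partial>\<^sub>2\<phi>\<close>.\<close>

definition weak_rot :: "plane set \<Rightarrow> (plane \<Rightarrow> plane) \<Rightarrow> (plane \<Rightarrow> real) \<Rightarrow> bool" where
  "weak_rot U v r \<longleftrightarrow> L2 U v \<and> L2 U r \<and>
     (\<forall>\<phi>\<in>test_functions U.
        (LINT x|lebesgue_on U. v x \<bullet> perp (grad \<phi> x)) = - (LINT x|lebesgue_on U. r x * \<phi> x))"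

definition H_div :: "plane set \<Rightarrow> (plane \<Rightarrow> plane) set" where
  "H_div U = {v. \<exists>d. weak_div U v d}"

definition H_rot :: "plane set \<Rightarrow> (plane \<Rightarrow> plane) set" where
  "H_rot U = {v. \<exists>r. weak_rot U v r}"


subsection \<open>Polygonal domains and meshes\<close>

definition lipschitz_boundary :: "plane set \<Rightarrow> bool" where
  "lipschitz_boundary U \<longleftrightarrow>
     (\<forall>x\<in>frontier U. \<exists>u r s L \<gamma>. norm u = 1 \<and> r > 0 \<and> s > 0 \<and> L-lipschitz_on UNIV \<gamma> \<and>
        (\<forall>a b :: real. \<bar>a\<bar> < r \<longrightarrow> \<bar>b\<bar> < s \<longrightarrow>
           (x + a *\<^sub>R u + b *\<^sub>R perp u \<in> U \<longleftrightarrow> b < \<gamma> a)))"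

definition polygonal_domain :: "plane set \<Rightarrow> bool" where
  "polygonal_domain U \<longleftrightarrow> open U \<and> bounded U \<and> connected U \<and> U \<noteq> {} \<and>
     (\<exists>S. finite S \<and> (\<forall>s\<in>S. \<exists>a b. s = closed_segment a b) \<and> frontier U = \<Union>S) \<and>
     lipschitz_boundary U"

text \<open>A simple polygon is given by the cyclic list of its vertices. Consecutive edges may be
  collinear (hanging nodes).\<close>

definition polygon_edge :: "plane list \<Rightarrow> nat \<Rightarrow> plane set" where
  "polygon_edge vs i = closed_segment (vs ! i) (vs ! (Suc i mod length vs))"

definition polygon_edges :: "plane list \<Rightarrow> plane set set" where
  "polygon_edges vs = polygon_edge vs ` {..<length vs}"

definition simple_polygon :: "plane list \<Rightarrow> bool" where
  "simple_polygon vs \<longleftrightarrow> length vs \<ge> 3 \<and> distinct vs \<and>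
     (\<forall>i<length vs. \<forall>j<length vs. i \<noteq> j \<longrightarrow>
        polygon_edge vs i \<inter> polygon_edge vs j
          \<subseteq> {vs ! i, vs ! (Suc i mod length vs)} \<inter> {vs ! j, vs ! (Suc j mod length vs)})"

text \<open>Elements are open sets, edges are closed segments; \<open>normal M e\<close> is the fixed normal of \<open>e\<close>,
  which does not depend on the element having \<open>e\<close> as an edge.\<close>

record mesh =
  elements :: "plane set set"
  edges :: "plane set \<Rightarrow> plane set set"
  normal :: "plane set \<Rightarrow> plane"

definition star_shaped_wrt_disk :: "plane set \<Rightarrow> real \<Rightarrow> bool" where
  "star_shaped_wrt_disk E r \<longleftrightarrow>
     (\<exists>c. ball c r \<subseteq> E \<and> (\<forall>x\<in>ball c r. \<forall>y\<in>E. closed_segment x y \<subseteq> E))"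

definition regular_mesh :: "plane set \<Rightarrow> real \<Rightarrow> mesh \<Rightarrow> bool" where
  "regular_mesh U \<rho> M \<longleftrightarrow>
     finite (elements M) \<and>
     (\<forall>E\<in>elements M. E \<subseteq> U \<and>
        (\<exists>vs. simple_polygon vs \<and> edges M E = polygon_edges vs \<and> E = inside (\<Union>(polygon_edges vs)))) \<and>
     pairwise disjnt (elements M) \<and>
     closure U = (\<Union>E\<in>elements M. closure E) \<and>
     (\<forall>E\<in>elements M. \<forall>e\<in>edges M E.
        norm (normal M e) = 1 \<and> (\<forall>x\<in>e. \<forall>y\<in>e. normal M e \<bullet> (x - y) = 0)) \<and>
     (\<forall>E\<in>elements M. (\<exists>r\<ge>\<rho> * diameter E. star_shaped_wrt_disk E r) \<and>
        (\<forall>e\<in>edges M E. diameter e \<ge> \<rho> * diameter E))"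

definition area :: "plane set \<Rightarrow> real" where
  "area E = measure lebesgue E"

definition barycenter :: "plane set \<Rightarrow> plane" where
  "barycenter E = (1 / area E) *\<^sub>R (LINT x|lebesgue_on E. x)"

definition edge_midpoint :: "plane set \<Rightarrow> plane" where
  "edge_midpoint e = (THE m. \<exists>a b. e = closed_segment a b \<and> m = midpoint a b)"

text \<open>The point of \<open>e\<close> at signed distance \<open>s\<close> from its midpoint; the length of an edge
  is its diameter.\<close>

definition edge_point :: "mesh \<Rightarrow> plane set \<Rightarrow> real \<Rightarrow> plane" where
  "edge_point M e s = edge_midpoint e + s *\<^sub>R perp (normal M e)"

definition edge_coords :: "plane set \<Rightarrow> real set" where
  "edge_coords e = {- diameter e / 2 .. diameter e / 2}"


subsection \<open>Normal traces\<close>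

text \<open>The value is 1 if the fixed normal of \<open>e\<close> points out of \<open>E\<close>, and -1 otherwise.\<close>

definition outward_sign :: "mesh \<Rightarrow> plane set \<Rightarrow> plane set \<Rightarrow> real" where
  "outward_sign M E e =
     (if \<forall>\<^sub>F t in at_right 0. edge_midpoint e - t *\<^sub>R normal M e \<in> E then 1 else - 1)"

text \<open>A field in \<open>H_div E\<close> has a normal trace on the boundary of \<open>E\<close> only in the weak sense given by
  Green's formula. Here \<open>g e\<close> represents this trace on \<open>e\<close>, taken with respect to \<open>normal M e\<close>.
  The trace is unique up to null sets of the edges.\<close>

definition has_normal_trace ::
    "mesh \<Rightarrow> plane set \<Rightarrow> (plane \<Rightarrow> plane) \<Rightarrow> (plane set \<Rightarrow> plane \<Rightarrow> real) \<Rightarrow> bool" where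
  "has_normal_trace M E v g \<longleftrightarrow>
     (\<forall>e\<in>edges M E. set_integrable lborel (edge_coords e) (\<lambda>s. g e (edge_point M e s))) \<and>
     (\<exists>d. weak_div E v d \<and>
        (\<forall>\<phi>. smooth \<phi> \<longrightarrow>
           (LINT x|lebesgue_on E. v x \<bullet> grad \<phi> x) + (LINT x|lebesgue_on E. d x * \<phi> x) =
           (\<Sum>e\<in>edges M E. outward_sign M E e *
              (LINT s:edge_coords e|lborel. g e (edge_point M e s) * \<phi> (edge_point M e s)))))"

definition normal_trace :: "mesh \<Rightarrow> plane set \<Rightarrow> (plane \<Rightarrow> plane) \<Rightarrow> plane set \<Rightarrow> plane \<Rightarrow> real" where
  "normal_trace M E v = (SOME g. has_normal_trace M E v g)"


subsection \<open>Discrete spaces and degrees of freedom\<close>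

definition V_local :: "mesh \<Rightarrow> nat \<Rightarrow> plane set \<Rightarrow> (plane \<Rightarrow> plane) set" where
  "V_local M k E = {v \<in> H_div E \<inter> H_rot E.
     (\<exists>g. has_normal_trace M E v g \<and> (\<forall>e\<in>edges M E. g e \<in> polys (int k) e)) \<and>
     (\<exists>d\<in>polys (int k) E. weak_div E v d) \<and>
     (\<exists>r\<in>polys (int k - 1) E. weak_rot E v r)}"

definition V_global :: "plane set \<Rightarrow> mesh \<Rightarrow> nat \<Rightarrow> (plane \<Rightarrow> plane) set" where
  "V_global U M k = {v \<in> H_div U. \<forall>E\<in>elements M. v \<in> V_local M k E}"

definition scaled_monomial :: "plane set \<Rightarrow> nat \<times> nat \<Rightarrow> plane \<Rightarrow> real" where
  "scaled_monomial E \<alpha> x =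
     ((x - barycenter E) $ 1 / diameter E) ^ fst \<alpha> * ((x - barycenter E) $ 2 / diameter E) ^ snd \<alpha>"

datatype dof_index = Edge_Dof "plane set" nat | Grad_Dof "nat \<times> nat" | Perp_Dof "nat \<times> nat"

definition dof_indices :: "mesh \<Rightarrow> nat \<Rightarrow> plane set \<Rightarrow> dof_index set" where
  "dof_indices M k E =
     {Edge_Dof e a | e a. e \<in> edges M E \<and> a \<le> k} \<union>
     Grad_Dof ` {\<alpha> \<in> multi_indices (int k). 1 \<le> fst \<alpha> + snd \<alpha>} \<union>
     Perp_Dof ` multi_indices (int k - 1)"

text \<open>The vector of degrees of freedom is indexed by \<open>dof_indices M k E\<close>.\<close>

primrec dof :: "mesh \<Rightarrow> plane set \<Rightarrow> (plane \<Rightarrow> plane) \<Rightarrow> dof_index \<Rightarrow> real" where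
  "dof M E v (Edge_Dof e a) =
     1 / diameter e *
       (LINT s:edge_coords e|lborel. normal_trace M E v e (edge_point M e s) * (s / diameter e) ^ a)"
| "dof M E v (Grad_Dof \<alpha>) =
     diameter E / area E * (LINT x|lebesgue_on E. v x \<bullet> grad (scaled_monomial E \<alpha>) x)"
| "dof M E v (Perp_Dof \<alpha>) =
     1 / area E *
       (LINT x|lebesgue_on E.
          (v x \<bullet> perp ((1 / diameter E) *\<^sub>R (x - barycenter E))) * scaled_monomial E \<alpha> x)"

text \<open>If \<open>dof M E w\<close> vanishes then so does the sum below, hence the whole product.\<close>

definition stab ::
    "real \<Rightarrow> mesh \<Rightarrow> nat \<Rightarrow> plane set \<Rightarrow> (plane \<Rightarrow> plane) \<Rightarrow> (plane \<Rightarrow> plane) \<Rightarrow> real" where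
  "stab p M k E w v =
     (diameter E)\<^sup>2 * L2_set (dof M E w) (dof_indices M k E) powr (conj_exp p - 2) *
       (\<Sum>i\<in>dof_indices M k E. dof M E w i * dof M E v i)"

end

theory Submission
  imports Defs
begin

text \<open>
  Write \<open>r = p'\<close>, \<open>A = dof w\<close> and \<open>B = dof z\<close> on an element. For
  \<open>r \<ge> 2\<close> the bound \<open>(|A|\<^sup>r\<^sup>-\<^sup>2A - |B|\<^sup>r\<^sup>-\<^sup>2B) \<bullet> (A - B) \<ge> 2\<^sup>1\<^sup>-\<^sup>r |A - B|\<^sup>r\<close> is summed over the mesh. For
  \<open>r < 2\<close> the left-hand side dominates \<open>(r - 1) (|A| + |B|)\<^sup>r\<^sup>-\<^sup>2 |A - B|\<^sup>2\<close>, and Hoelder's inequality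
  with exponents \<open>2 / r\<close> and \<open>2 / (2 - r)\<close> concludes.

  This needs \<open>dof (w - z) = dof w - dof z\<close>, hence the uniqueness of normal traces. Two traces and
  divergences of the same field differ by data \<open>D\<close>, \<open>k\<close> with
  \<open>\<integral>\<^sub>E D \<psi> = \<Sum>\<^sub>e \<plusminus>\<integral>\<^sub>e k \<psi>\<close> for all polynomials \<open>\<psi>\<close>. By the Weierstrass theorem this
  extends to continuous \<open>\<psi>\<close>, and by dominated convergence to the product of a continuous function
  with the indicator of a single edge. The left-hand side then vanishes, so neither bump
  functions nor uniqueness of the weak divergence are needed.
\<close>

subsection \<open>Monotonicity of power maps\<close>

text \<open>Read \<open>a\<close>, \<open>b\<close> as the norms of two vectors and \<open>t\<close>
  as their inner product. The first summand is the gap for parallel vectors, the second carries the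
  Cauchy-Schwarz defect \<open>a * b - t\<close>; each is then bounded on its own.\<close>

lemma power_gap_expand:
  fixes \<alpha> \<beta> a b t :: real
  shows "\<alpha> * (a\<^sup>2 - t) - \<beta> * (t - b\<^sup>2) = (\<alpha> * a - \<beta> * b) * (a - b) + (\<alpha> + \<beta>) * (a * b - t)"
  by (simp add: power2_eq_square algebra_simps)

text \<open>With \<open>\<alpha>\<close>, \<open>\<beta>\<close> the powers of the two norms, the
  right-hand side is half of \<open>(\<alpha> + \<beta>) * d\<^sup>2\<close> plus half of
  \<open>(\<alpha> - \<beta>) * (a\<^sup>2 - b\<^sup>2)\<close>. The latter is nonnegative by
  monotonicity of the power, and \<open>d \<le> 2 * max a b\<close> bounds the former from
  below.\<close>

lemma power_gap_ge_superquadratic: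
  fixes a b t d r :: real
  assumes r: "2 \<le> r" and a: "0 \<le> a" and b: "0 \<le> b" and d: "0 \<le> d"
    and t: "\<bar>t\<bar> \<le> a * b" and d2: "d\<^sup>2 = a\<^sup>2 + b\<^sup>2 - 2 * t"
  shows "2 powr (1 - r) * d powr r \<le> a powr (r - 2) * (a\<^sup>2 - t) - b powr (r - 2) * (t - b\<^sup>2)"
proof (cases "d = 0")
  case True
  have "a = b"
  proof -
    have "(a - b)\<^sup>2 \<le> 0" using t d2 True unfolding power2_diff by simp
    then show ?thesis by simp
  qed
  then show ?thesis using True d2 by (simp add: power2_eq_square algebra_simps)
next
  case False
  define \<alpha> where "\<alpha> = a powr (r - 2)"
  define \<beta> where "\<beta> = b powr (r - 2)"
  have dpos: "0 < d" using False d by simp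
  have "d\<^sup>2 \<le> (a + b)\<^sup>2" using t unfolding d2 power2_sum by linarith
  then have dab: "d \<le> a + b" by (rule power2_le_imp_le) (use a b in simp)
  have "(\<alpha> - \<beta>) * (a - b) \<ge> 0"
  proof (cases "a \<le> b")
    case True
    then have "\<alpha> \<le> \<beta>" unfolding \<alpha>_def \<beta>_def using a r by (simp add: powr_mono2)
    then show ?thesis using True by (simp add: mult_nonpos_nonpos)
  next
    case False
    then have "\<beta> \<le> \<alpha>" unfolding \<alpha>_def \<beta>_def using b r by (simp add: powr_mono2)
    then show ?thesis using False by simp
  qed
  then have "(\<alpha> - \<beta>) * (a - b) * (a + b) \<ge> 0" using a b by simp
  then have mono: "0 \<le> (\<alpha> - \<beta>) * (a\<^sup>2 - b\<^sup>2)" by (simp add: power2_eq_square algebra_simps)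
  have "d powr (r - 2) \<le> (2 * max a b) powr (r - 2)"
    using dab dpos r by (intro powr_mono2) auto
  also have "\<dots> = 2 powr (r - 2) * max a b powr (r - 2)" using a b by (simp add: powr_mult)
  also have "\<dots> \<le> 2 powr (r - 2) * (\<alpha> + \<beta>)"
    unfolding \<alpha>_def \<beta>_def by (intro mult_left_mono) (auto simp: max_def)
  finally have key: "d powr (r - 2) \<le> 2 powr (r - 2) * (\<alpha> + \<beta>)" .
  have "2 powr (1 - r) * d powr r = 2 powr (1 - r) * (d powr (r - 2) * d\<^sup>2)"
    using dpos by (simp add: powr_diff powr_numeral)
  also have "\<dots> \<le> 2 powr (1 - r) * ((2 powr (r - 2) * (\<alpha> + \<beta>)) * d\<^sup>2)"
    by (intro mult_left_mono mult_right_mono key) auto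
  also have "\<dots> = (2 powr (1 - r) * 2 powr (r - 2)) * ((\<alpha> + \<beta>) * d\<^sup>2)" by (simp add: mult_ac)
  \<comment> \<open>The constant \<open>2 powr (1 - r)\<close> is chosen to leave exactly the factor
    1/2 of the splitting.\<close>
  also have "2 powr (1 - r) * 2 powr (r - 2) = (1 / 2 :: real)"
    by (simp add: powr_add[symmetric] powr_minus)
  also have "1 / 2 * ((\<alpha> + \<beta>) * d\<^sup>2) \<le> 1 / 2 * ((\<alpha> + \<beta>) * d\<^sup>2) + 1 / 2 * ((\<alpha> - \<beta>) * (a\<^sup>2 - b\<^sup>2))"
    using mono by simp
  also have "\<dots> = \<alpha> * (a\<^sup>2 - t) - \<beta> * (t - b\<^sup>2)"
    unfolding d2 by (simp add: field_simps)
  finally show ?thesis by (simp add: \<alpha>_def \<beta>_def)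
qed

text \<open>The squared distance splits as \<open>(a - b)\<^sup>2 + 2 * (a * b - t)\<close>. The
  mean value theorem for \<open>s powr (r - 1)\<close> handles the first part, and monotonicity of
  the negative power \<open>r - 2\<close> the second.\<close>

lemma power_gap_ge_subquadratic:
  fixes a b t d r :: real
  assumes r: "1 < r" "r < 2" and a: "0 \<le> a" and b: "0 \<le> b"
    and t: "\<bar>t\<bar> \<le> a * b" and d2: "d\<^sup>2 = a\<^sup>2 + b\<^sup>2 - 2 * t"
  shows "(r - 1) * (a + b) powr (r - 2) * d\<^sup>2 \<le> a powr (r - 2) * (a\<^sup>2 - t) - b powr (r - 2) * (t - b\<^sup>2)"
proof -
  \<comment> \<open>The intermediate point lies below \<open>x + y\<close>, and the derivative
    decreases because \<open>r - 2 < 0\<close>.\<close>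
  have gap: "(r - 1) * (x + y) powr (r - 2) * (x - y) \<le> x powr (r - 1) - y powr (r - 1)"
    if "0 < y" "y < x" for x y :: real
  proof -
    have "((\<lambda>s. s powr (r - 1)) has_real_derivative (r - 1) * s powr (r - 1 - 1)) (at s)"
      if "y \<le> s" for s using that \<open>0 < y\<close> by (intro has_real_derivative_powr) simp
    then obtain \<xi> where \<xi>: "y < \<xi>" "\<xi> < x"
      and eq: "x powr (r - 1) - y powr (r - 1) = (x - y) * ((r - 1) * \<xi> powr (r - 1 - 1))"
      using MVT2[OF \<open>y < x\<close>, of "\<lambda>s. s powr (r - 1)" "\<lambda>s. (r - 1) * s powr (r - 1 - 1)"]
      by blast
    have "(x + y) powr (r - 2) \<le> \<xi> powr (r - 2)"
      using \<xi> that r by (intro powr_mono2') auto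
    then show ?thesis unfolding eq using that r by (simp add: mult_left_mono mult_ac)
  qed
  define \<alpha> where "\<alpha> = a powr (r - 2)"
  define \<beta> where "\<beta> = b powr (r - 2)"
  define \<kappa> where "\<kappa> = (r - 1) * (a + b) powr (r - 2)"
  have \<alpha>a: "\<alpha> * a = a powr (r - 1)" and \<beta>b: "\<beta> * b = b powr (r - 1)"
    unfolding \<alpha>_def \<beta>_def using a b powr_mult_base[of a "r - 2"] powr_mult_base[of b "r - 2"] by (simp_all add: mult.commute)
  have diag: "\<kappa> * (a - b)\<^sup>2 \<le> (\<alpha> * a - \<beta> * b) * (a - b)"
  proof -
    \<comment> \<open>Zero norms are split off since \<open>gap\<close> starts from a positive
      number. There one power is \<open>0 powr (r - 2) = 0\<close> and \<open>r - 1 < 1\<close>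
      suffices.\<close>
    consider "a = b" | "a = 0" "a \<noteq> b" | "b = 0" "a \<noteq> b" | "0 < b" "b < a" | "0 < a" "a < b" using a b by linarith
    then show ?thesis
    proof cases
      case 2
      have "(r - 1) * (\<beta> * b\<^sup>2) \<le> 1 * (\<beta> * b\<^sup>2)"
        using r by (intro mult_right_mono) (auto simp: \<beta>_def)
      then show ?thesis using 2 by (simp add: \<kappa>_def \<beta>_def power2_eq_square mult.assoc)
    next
      case 3
      have "(r - 1) * (\<alpha> * a\<^sup>2) \<le> 1 * (\<alpha> * a\<^sup>2)"
        using r by (intro mult_right_mono) (auto simp: \<alpha>_def)
      then show ?thesis using 3 by (simp add: \<kappa>_def \<alpha>_def power2_eq_square mult.assoc)
    next
      case 4
      then have "\<kappa> * (a - b) * (a - b) \<le> (\<alpha> * a - \<beta> * b) * (a - b)"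
        using gap[of b a] unfolding \<alpha>a \<beta>b \<kappa>_def by (intro mult_right_mono) auto
      then show ?thesis by (simp add: power2_eq_square mult.assoc)
    next
      case 5
      then have "\<kappa> * (b - a) * (b - a) \<le> (\<beta> * b - \<alpha> * a) * (b - a)"
        using gap[of a b] unfolding \<alpha>a \<beta>b \<kappa>_def by (intro mult_right_mono) (auto simp: add.commute)
      then have "\<kappa> * (b - a)\<^sup>2 \<le> (\<beta> * b - \<alpha> * a) * (b - a)" by (simp add: power2_eq_square mult.assoc)
      also have "\<dots> = (\<alpha> * a - \<beta> * b) * (a - b)" by (simp add: algebra_simps)
      finally show ?thesis by (simp only: power2_commute)
    qed simp
  qed
  have cross: "2 * \<kappa> * (a * b - t) \<le> (\<alpha> + \<beta>) * (a * b - t)"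
  \<comment> \<open>For a zero norm the value \<open>0 powr (r - 2) = 0\<close> spoils the
    comparison of powers, but then \<open>t = 0\<close> and both sides vanish.\<close>
  proof (cases "a = 0 \<or> b = 0")
    case False
    have "(a + b) powr (r - 2) \<le> \<alpha>" "(a + b) powr (r - 2) \<le> \<beta>"
      unfolding \<alpha>_def \<beta>_def using False a b r by (auto intro!: powr_mono2')
    moreover have "\<kappa> \<le> (a + b) powr (r - 2)"
      unfolding \<kappa>_def using r by (simp add: mult_left_le_one_le)
    ultimately show ?thesis using t by (intro mult_right_mono) auto
  qed (use t in auto)
  have "\<kappa> * d\<^sup>2 = \<kappa> * (a - b)\<^sup>2 + 2 * \<kappa> * (a * b - t)"
    unfolding d2 by (simp add: power2_eq_square algebra_simps)
  with diag cross show ?thesis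
    using power_gap_expand[of \<alpha> a t \<beta> b] by (simp add: \<alpha>_def \<beta>_def \<kappa>_def)
qed

section \<open>Summation over the elements\<close>

text \<open>Trades the weight \<open>a + b\<close> for the sum of \<open>r\<close>-th powers, which
  is additive over the elements. Both are compared with \<open>m = max a b\<close>:
  \<open>a + b \<le> 2 * m\<close> and \<open>m powr r\<close> is at most the sum, and all exponents
  involved are negative.\<close>

lemma powr_sum_le:
  fixes a b r :: real
  assumes "1 < r" "r < 2" "0 \<le> a" "0 \<le> b"
  shows "2 powr (r - 2) * (a powr r + b powr r) powr ((r - 2) / r) \<le> (a + b) powr (r - 2)"
proof (cases "a + b = 0")
  case False
  have pos: "0 < a + b" using False assms by simp
  define m where "m = max a b"
  have m: "0 < m" "a + b \<le> 2 * m" using assms pos by (auto simp: m_def)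
  have "m powr r \<le> a powr r + b powr r" by (auto simp: m_def max_def)
  then have "(a powr r + b powr r) powr ((r - 2) / r) \<le> (m powr r) powr ((r - 2) / r)"
    using m assms by (intro powr_mono2') (auto simp: divide_nonpos_pos)
  also have "\<dots> = m powr (r - 2)" using assms by (simp add: powr_powr)
  finally have "2 powr (r - 2) * (a powr r + b powr r) powr ((r - 2) / r) \<le> 2 powr (r - 2) * m powr (r - 2)"
    by simp
  also have "\<dots> = (2 * m) powr (r - 2)" using m by (simp add: powr_mult)
  also have "\<dots> \<le> (a + b) powr (r - 2)" using m pos assms by (intro powr_mono2') auto
  finally show ?thesis .
qed (use assms in \<open>auto simp: add_nonneg_eq_0_iff\<close>)

text \<open>The conjugate exponents are \<open>1 / \<theta>\<close> and
  \<open>1 / (1 - \<theta>)\<close>. After both sums are normalised to 1, Young's inequality is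
  applied term by term.\<close>

lemma Holder_inequality_sum:
  fixes f g :: "'a \<Rightarrow> real"
  assumes "finite I" "\<And>i. i \<in> I \<Longrightarrow> 0 \<le> f i" "\<And>i. i \<in> I \<Longrightarrow> 0 \<le> g i"
    and \<theta>: "0 < \<theta>" "\<theta> < 1"
  shows "(\<Sum>i\<in>I. f i powr \<theta> * g i powr (1 - \<theta>)) \<le> sum f I powr \<theta> * sum g I powr (1 - \<theta>)"
proof (cases "sum f I = 0 \<or> sum g I = 0")
  case True
  then have "(\<forall>i\<in>I. f i = 0) \<or> (\<forall>i\<in>I. g i = 0)"
    using assms by (metis sum_nonneg_eq_0_iff)
  then have "(\<Sum>i\<in>I. f i powr \<theta> * g i powr (1 - \<theta>)) = 0" by (auto intro!: sum.neutral)
  then show ?thesis by simp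
next
  case False
  define F where "F = sum f I"
  define G where "G = sum g I"
  have F: "0 < F" and G: "0 < G" using False assms sum_nonneg[of I f] sum_nonneg[of I g] by (auto simp: F_def G_def less_le)
  have young: "x powr \<theta> * y powr (1 - \<theta>) \<le> \<theta> * x + (1 - \<theta>) * y" if "0 \<le> x" "0 \<le> y" for x y :: real
    using Youngs_inequality_0[of \<theta> "1 - \<theta>" x y] \<theta> that by (cases "x = 0 \<or> y = 0") auto
  have "(\<Sum>i\<in>I. f i powr \<theta> * g i powr (1 - \<theta>)) =
      F powr \<theta> * G powr (1 - \<theta>) * (\<Sum>i\<in>I. (f i / F) powr \<theta> * (g i / G) powr (1 - \<theta>))"
    unfolding sum_distrib_left using F G assms by (intro sum.cong) (auto simp: powr_divide)
  also have "\<dots> \<le> F powr \<theta> * G powr (1 - \<theta>) * (\<Sum>i\<in>I. \<theta> * (f i / F) + (1 - \<theta>) * (g i / G))"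
    using F G assms by (intro mult_left_mono sum_mono young) auto
  also have "(\<Sum>i\<in>I. \<theta> * (f i / F) + (1 - \<theta>) * (g i / G)) = \<theta> * (F / F) + (1 - \<theta>) * (G / G)"
    unfolding sum.distrib sum_distrib_left[symmetric] sum_divide_distrib[symmetric] by (simp add: F_def G_def)
  also have "\<dots> = 1" using F G by simp
  finally show ?thesis by (simp add: F_def G_def)
qed

text \<open>The analytic core of the theorem, with the elements abstracted to \<open>I\<close>, the
  squared diameters to \<open>h\<close>, and the vectors of degrees of freedom to their norms and
  inner products.\<close>

lemma sum_power_gap_ge:
  fixes a b t d h :: "'a \<Rightarrow> real"
  assumes I: "finite I" and r: "1 < r"
    and h: "\<And>i. i \<in> I \<Longrightarrow> 0 \<le> h i" and a: "\<And>i. i \<in> I \<Longrightarrow> 0 \<le> a i" and b: "\<And>i. i \<in> I \<Longrightarrow> 0 \<le> b i"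
    and d: "\<And>i. i \<in> I \<Longrightarrow> 0 \<le> d i" and t: "\<And>i. i \<in> I \<Longrightarrow> \<bar>t i\<bar> \<le> a i * b i"
    and d2: "\<And>i. i \<in> I \<Longrightarrow> (d i)\<^sup>2 = (a i)\<^sup>2 + (b i)\<^sup>2 - 2 * t i"
  shows "(\<Sum>i\<in>I. h i * (a i powr (r - 2) * ((a i)\<^sup>2 - t i) - b i powr (r - 2) * (t i - (b i)\<^sup>2))) \<ge>
    (if r < 2 then (r - 1) * 2 powr (r - 2) else 2 powr (1 - r)) *
      rpow (\<Sum>i\<in>I. h i * (a i powr r + b i powr r)) ((min r 2 - 2) / r) *
      rpow (\<Sum>i\<in>I. h i * d i powr r) (max r 2 / r)" (is "?L \<ge> _")
proof (cases "r < 2")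
  case False
  then have "2 \<le> r" by simp
  \<comment> \<open>Here the exponents in the claim are 0 and 1, so summing the elementwise bounds
    is enough.\<close>
  have "(\<Sum>i\<in>I. 2 powr (1 - r) * (h i * d i powr r)) \<le> ?L"
  proof (rule sum_mono)
    fix i assume i: "i \<in> I"
    show "2 powr (1 - r) * (h i * d i powr r) \<le>
        h i * (a i powr (r - 2) * ((a i)\<^sup>2 - t i) - b i powr (r - 2) * (t i - (b i)\<^sup>2))"
      using mult_left_mono[OF power_gap_ge_superquadratic[OF \<open>2 \<le> r\<close> a[OF i] b[OF i] d[OF i] t[OF i] d2[OF i]] h[OF i]]
      by (simp add: mult_ac)
  qed
  moreover have "0 \<le> (\<Sum>i\<in>I. h i * d i powr r)" using h by (simp add: sum_nonneg)
  ultimately show ?thesis using False r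
    by (simp add: rpow_def min_def max_def sum_distrib_left)
next
  case True
  define S where "S i = a i powr r + b i powr r" for i
  \<comment> \<open>Up to the constant \<open>c\<close>, the elementwise lower bound after
    \<open>a i + b i\<close> has been traded for \<open>S i\<close>.\<close>
  define X where "X i = S i powr ((r - 2) / r) * (d i)\<^sup>2" for i
  define c where "c = (r - 1) * 2 powr (r - 2)"
  have c: "0 < c" using r by (simp add: c_def)
  have "c * (\<Sum>i\<in>I. h i * X i) = (\<Sum>i\<in>I. h i * (c * X i))" by (simp add: sum_distrib_left mult_ac)
  also have "\<dots> \<le> ?L"
  proof (intro sum_mono mult_left_mono h)
    fix i assume i: "i \<in> I"
    have "c * X i = (r - 1) * (2 powr (r - 2) * S i powr ((r - 2) / r)) * (d i)\<^sup>2"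
      by (simp add: c_def X_def)
    also have "\<dots> \<le> (r - 1) * (a i + b i) powr (r - 2) * (d i)\<^sup>2"
      unfolding S_def using powr_sum_le[OF r True a[OF i] b[OF i]] r
      by (intro mult_right_mono mult_left_mono) auto
    also have "\<dots> \<le> a i powr (r - 2) * ((a i)\<^sup>2 - t i) - b i powr (r - 2) * (t i - (b i)\<^sup>2)"
      by (rule power_gap_ge_subquadratic[OF r True a[OF i] b[OF i] t[OF i] d2[OF i]])
    finally show "c * X i \<le> a i powr (r - 2) * ((a i)\<^sup>2 - t i) - b i powr (r - 2) * (t i - (b i)\<^sup>2)" .
  qed
  finally have lower: "c * (\<Sum>i\<in>I. h i * X i) \<le> ?L" .
  define T where "T = (\<Sum>i\<in>I. h i * S i)"
  define Y where "Y = (\<Sum>i\<in>I. h i * X i)"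
  define Z where "Z = (\<Sum>i\<in>I. h i * d i powr r)"
  have S0: "0 \<le> S i" for i by (simp add: S_def)
  have X0: "0 \<le> X i" for i by (simp add: X_def)
  have T0: "0 \<le> T" and Y0: "0 \<le> Y" and Z0: "0 \<le> Z"
    unfolding T_def Y_def Z_def using h S0 X0 by (auto intro!: sum_nonneg)
  \<comment> \<open>In each product the powers of \<open>S i\<close> cancel and those of
    \<open>h i\<close> add up to 1, leaving \<open>h i * d i powr r\<close>; Hoelder's inequality
    with \<open>\<theta> = r / 2\<close> then applies.\<close>
  have "Z \<le> (\<Sum>i\<in>I. (h i * X i) powr (r / 2) * (h i * S i) powr (1 - r / 2))"
    unfolding Z_def
  proof (rule sum_mono)
    fix i assume i: "i \<in> I"
    show "h i * d i powr r \<le> (h i * X i) powr (r / 2) * (h i * S i) powr (1 - r / 2)"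
    proof (cases "S i = 0 \<or> h i = 0 \<or> d i = 0")
      case True
      \<comment> \<open>The cancellation fails at \<open>S i = 0\<close>, but there both norms
        vanish and so does their distance.\<close>
      have "d i = 0" if "S i = 0"
      proof -
        have "a i = 0" "b i = 0" using that by (auto simp: S_def add_nonneg_eq_0_iff)
        then show ?thesis using d2[OF i] t[OF i] by simp
      qed
      then show ?thesis using True by auto
    next
      case False
      then have pos: "0 < S i" "0 < h i" "0 < d i" using S0[of i] h[OF i] d[OF i] by auto
      have "(h i * X i) powr (r / 2) * (h i * S i) powr (1 - r / 2)
          = (h i powr (r / 2) * h i powr (1 - r / 2)) *
            (S i powr ((r - 2) / r * (r / 2)) * S i powr (1 - r / 2)) * ((d i)\<^sup>2) powr (r / 2)"
        using pos by (simp add: X_def powr_mult powr_powr)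
      also have "h i powr (r / 2) * h i powr (1 - r / 2) = h i"
        using pos by (simp add: powr_add[symmetric])
      also have "S i powr ((r - 2) / r * (r / 2)) * S i powr (1 - r / 2) = 1"
        using pos r by (simp add: powr_add[symmetric] field_simps)
      also have "((d i)\<^sup>2) powr (r / 2) = (d i powr 2) powr (r / 2)" using pos by simp
      also have "\<dots> = d i powr r" by (simp only: powr_powr) simp
      finally show ?thesis by simp
    qed
  qed
  also have "\<dots> \<le> Y powr (r / 2) * T powr (1 - r / 2)"
    unfolding Y_def T_def using I h S0 X0 r True by (intro Holder_inequality_sum) auto
  finally have "Z powr (2 / r) \<le> (Y powr (r / 2) * T powr (1 - r / 2)) powr (2 / r)"
    using Z0 r by (intro powr_mono2) auto
  also have "\<dots> = Y * T powr ((2 - r) / r)"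
  proof -
    have "(1 - r / 2) * (2 / r) = (2 - r) / r" using r by (simp add: field_simps)
    then show ?thesis using Y0 T0 r by (simp only: powr_mult powr_powr powr_ge_zero) simp
  qed
  finally have Z: "Z powr (2 / r) \<le> Y * T powr ((2 - r) / r)" .
  have "T powr ((r - 2) / r) * Z powr (2 / r) \<le> T powr ((r - 2) / r) * (Y * T powr ((2 - r) / r))"
    by (intro mult_left_mono Z) auto
  also have "\<dots> = Y * T powr ((r - 2) / r + (2 - r) / r)" by (simp add: powr_add)
  \<comment> \<open>The exponents of \<open>T\<close> add up to 0, and \<open>T powr 0\<close> is 1,
    or 0 if \<open>T = 0\<close>; hence an inequality rather than an equality.\<close>
  also have "\<dots> \<le> Y"
    using Y0 by (simp add: add_divide_distrib[symmetric])
  finally have "c * (T powr ((r - 2) / r) * Z powr (2 / r)) \<le> ?L"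
    using lower c unfolding Y_def[symmetric] by (meson mult_left_mono less_imp_le order_trans)
  then show ?thesis using True r
    by (simp add: rpow_def c_def T_def S_def Z_def mult.assoc)
qed

subsection \<open>Linearity of the degrees of freedom\<close>

text \<open>The sum and product rules keep partial derivatives polynomial, so the argument can be
  iterated along the recursion of \<open>C_n\<close>.\<close>

lemma real_polynomial_function_grad:
  assumes "real_polynomial_function (f :: plane \<Rightarrow> real)"
  shows "(\<forall>x. f differentiable at x) \<and> (\<forall>i. real_polynomial_function (\<lambda>x. grad f x $ i))"
  using assms
proof induction
  case (linear f)
  then have "(f has_derivative f) (at x)" for x by (rule bounded_linear_imp_has_derivative)
  then have "f differentiable at x" "frechet_derivative f (at x) = f" for x
    using frechet_derivative_at[of f f x, symmetric] by (auto simp: differentiable_def)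
  then show ?case by (simp add: grad_def real_polynomial_function.intros(2))
next
  case (const c)
  then show ?case by (simp add: grad_def real_polynomial_function.intros(2))
next
  case (add f g)
  have "grad (\<lambda>x. f x + g x) x $ i = grad f x $ i + grad g x $ i" for x i
  proof -
    have "((\<lambda>x. f x + g x) has_derivative
        (\<lambda>h. frechet_derivative f (at x) h + frechet_derivative g (at x) h)) (at x)"
      using add.IH by (intro has_derivative_add) (auto simp: frechet_derivative_works[symmetric])
    from frechet_derivative_at[OF this, symmetric] show ?thesis by (simp add: grad_def)
  qed
  with add show ?case by (simp add: real_polynomial_function.intros(3))
next
  case (mult f g)
  have "grad (\<lambda>x. f x * g x) x $ i = f x * grad g x $ i + grad f x $ i * g x" for x i
  proof -
    have "((\<lambda>x. f x * g x) has_derivative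
        (\<lambda>h. f x * frechet_derivative g (at x) h + frechet_derivative f (at x) h * g x)) (at x)"
      using mult.IH by (intro has_derivative_mult) (auto simp: frechet_derivative_works[symmetric])
    from frechet_derivative_at[OF this, symmetric] show ?thesis by (simp add: grad_def)
  qed
  with mult show ?case by (simp add: real_polynomial_function.intros(3,4))
qed

text \<open>Makes polynomials admissible in Green's formula of \<open>has_normal_trace\<close>,
  which ranges over all smooth functions without a support condition.\<close>

lemma real_polynomial_function_smooth:
  assumes "real_polynomial_function f"
  shows "smooth f"
proof -
  have "C_n n f" if "real_polynomial_function f" for n f
    using that
  proof (induction n arbitrary: f)
    case 0
    then show ?case
      by (auto intro: continuous_on_polymonial_function simp: real_polynomial_function_eq)
  next
    case (Suc n)
    then show ?case using real_polynomial_function_grad by auto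
  qed
  with assms show ?thesis by (auto simp: smooth_def)
qed

lemma smooth_continuous_on: "smooth f \<Longrightarrow> continuous_on A f"
  unfolding smooth_def by (metis C_n.simps(1) continuous_on_subset subset_UNIV)

lemma smooth_continuous_on_grad:
  assumes "smooth f"
  shows "continuous_on A (grad f)"
proof -
  have "C_n (Suc 0) f" using assms by (simp only: smooth_def)
  then have "continuous_on UNIV (\<lambda>x. grad f x $ i)" for i by simp
  then have "continuous_on UNIV (\<lambda>x. \<chi> i. grad f x $ i)" by (intro continuous_on_vec_lambda) auto
  then have "continuous_on UNIV (grad f)" by simp
  then show ?thesis by (rule continuous_on_subset) simp
qed

lemma continuous_on_perp [continuous_intros]:
  assumes "continuous_on A f"
  shows "continuous_on A (\<lambda>x. perp (f x))"
proof -
  have "continuous_on A (\<lambda>x. (\<chi> i. if i = 1 then - f x $ 2 else f x $ 1) :: plane)"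
  proof (rule continuous_on_vec_lambda)
    show "continuous_on A (\<lambda>x. if i = 1 then - f x $ 2 else f x $ 1)" for i :: 2
      using assms by (cases "i = 1") (auto intro!: continuous_intros)
  qed
  moreover have "perp a = (\<chi> i. if i = 1 then - a $ 2 else a $ 1)" for a
    by (simp add: perp_def vec_eq_iff forall_2)
  ultimately show ?thesis by simp
qed

lemma real_polynomial_function_scaled_monomial: "real_polynomial_function (scaled_monomial E \<alpha>)"
proof -
  have comp: "real_polynomial_function (\<lambda>x::plane. (x - barycenter E) $ i / diameter E)" for i
    by (intro real_polynomial_function_divide) (simp, intro real_polynomial_function_diff real_polynomial_function.intros(1,2) bounded_linear_vec_nth)
  show ?thesis
    unfolding scaled_monomial_def[abs_def]
    by (intro real_polynomial_function.intros(4) real_polynomial_function_power comp)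
qed

section \<open>Integrability of products and linearity of Green's formula\<close>

lemma integrable_inner_bounded:
  fixes f g :: "'a \<Rightarrow> 'b::euclidean_space"
  assumes "integrable M f" "g \<in> borel_measurable M" "\<And>x. x \<in> space M \<Longrightarrow> norm (g x) \<le> B"
  shows "integrable M (\<lambda>x. f x \<bullet> g x)"
proof (rule Bochner_Integration.integrable_bound)
  show "integrable M (\<lambda>x. B * norm (f x))" using assms by simp
  show "(\<lambda>x. f x \<bullet> g x) \<in> borel_measurable M" using assms by (intro borel_measurable_inner) auto
  have "\<bar>f x \<bullet> g x\<bar> \<le> \<bar>B * norm (f x)\<bar>" if "x \<in> space M" for x
  proof -
    have "\<bar>f x \<bullet> g x\<bar> \<le> norm (f x) * norm (g x)" by (rule Cauchy_Schwarz_ineq2)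
    also have "\<dots> \<le> norm (f x) * B" using assms(3)[OF that] by (intro mult_left_mono) auto
    finally show ?thesis by (simp add: mult.commute)
  qed
  then show "AE x in M. norm (f x \<bullet> g x) \<le> norm (B * norm (f x))" by simp
qed

lemma L2_diff:
  assumes "L2 U f" "L2 U g"
  shows "L2 U (f - g)"
proof -
  let ?M = "lebesgue_on U"
  have m: "f \<in> borel_measurable ?M" "g \<in> borel_measurable ?M" using assms by (auto simp: L2_def)
  have "integrable ?M (\<lambda>x. (norm (f x - g x))\<^sup>2)"
  proof (rule Bochner_Integration.integrable_bound)
    show "integrable ?M (\<lambda>x. 2 * (norm (f x))\<^sup>2 + 2 * (norm (g x))\<^sup>2)" using assms by (simp add: L2_def)
    show "(\<lambda>x. (norm (f x - g x))\<^sup>2) \<in> borel_measurable ?M" using m by measurable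
    have "(norm (f x - g x))\<^sup>2 \<le> 2 * (norm (f x))\<^sup>2 + 2 * (norm (g x))\<^sup>2" for x
    proof -
      have "(norm (f x - g x))\<^sup>2 \<le> (norm (f x) + norm (g x))\<^sup>2"
        by (intro power_mono norm_triangle_ineq4) simp
      also have "\<dots> \<le> 2 * (norm (f x))\<^sup>2 + 2 * (norm (g x))\<^sup>2"
        using zero_le_power2[of "norm (f x) - norm (g x)"] unfolding power2_sum power2_diff by linarith
      finally show ?thesis .
    qed
    then show "AE x in ?M. norm ((norm (f x - g x))\<^sup>2) \<le> norm (2 * (norm (f x))\<^sup>2 + 2 * (norm (g x))\<^sup>2)"
      by auto
  qed
  with m show ?thesis by (auto simp: L2_def fun_diff_def)
qed

text \<open>On a set of finite measure this follows from
  \<open>norm y \<le> 1 + (norm y)\<^sup>2\<close>.\<close>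

lemma L2_integrable:
  assumes "L2 U f" "U \<in> lmeasurable"
  shows "integrable (lebesgue_on U) f"
proof (rule Bochner_Integration.integrable_bound)
  have "finite_measure (lebesgue_on U)" using assms(2) by (simp add: finite_measure_lebesgue_on)
  then show "integrable (lebesgue_on U) (\<lambda>x. 1 + (norm (f x))\<^sup>2)"
    using assms(1) by (simp add: L2_def finite_measure.integrable_const)
  show "f \<in> borel_measurable (lebesgue_on U)" using assms(1) by (simp add: L2_def)
  have "norm (f x) \<le> 1 + (norm (f x))\<^sup>2" for x
    using zero_le_power2[of "norm (f x) - 1"] norm_ge_zero[of "f x"] unfolding power2_diff one_power2 by linarith
  then show "AE x in lebesgue_on U. norm (f x) \<le> norm (1 + (norm (f x))\<^sup>2)"
    by auto
qed

text \<open>A continuous \<open>g\<close> is bounded on the compact closure of \<open>U\<close>. The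
  general range type covers gradients and, with the inner product of the reals, scalar test
  functions.\<close>

lemma L2_integrable_inner:
  fixes g :: "plane \<Rightarrow> 'b::euclidean_space"
  assumes "L2 U f" "bounded U" "open U" "continuous_on UNIV g"
  shows "integrable (lebesgue_on U) (\<lambda>x. f x \<bullet> g x)"
proof -
  have "U \<in> lmeasurable" using assms by (simp add: lmeasurable_open)
  have "compact (g ` closure U)"
    using assms by (intro compact_continuous_image) (auto intro: continuous_on_subset simp: compact_closure)
  then have "bounded (g ` closure U)" by (rule compact_imp_bounded)
  then obtain B where B: "\<And>y. y \<in> g ` closure U \<Longrightarrow> norm y \<le> B"
    unfolding bounded_iff by blast
  show ?thesis
  proof (rule integrable_inner_bounded)
    show "integrable (lebesgue_on U) f" by (rule L2_integrable) fact+
    show "g \<in> borel_measurable (lebesgue_on U)"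
      using assms by (intro continuous_imp_measurable_on_sets_lebesgue) (auto intro: continuous_on_subset)
    show "norm (g x) \<le> B" if "x \<in> space (lebesgue_on U)" for x
    proof -
      have "g x \<in> g ` closure U" using that closure_subset[of U] by auto
      then show ?thesis by (rule B)
    qed
  qed
qed

lemma set_integrable_mult_continuous:
  fixes f g :: "real \<Rightarrow> real"
  assumes "set_integrable lborel {a..b} f" "continuous_on UNIV g"
  shows "set_integrable lborel {a..b} (\<lambda>s. f s * g s)"
proof -
  have "compact (g ` {a..b})"
    using assms by (intro compact_continuous_image) (auto intro: continuous_on_subset)
  then have "bounded (g ` {a..b})" by (rule compact_imp_bounded)
  then obtain B where B: "\<And>y. y \<in> g ` {a..b} \<Longrightarrow> norm y \<le> B"
    unfolding bounded_iff by blast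
  have g: "g \<in> borel_measurable lborel" using assms by (simp add: borel_measurable_continuous_onI)
  have "integrable lborel (\<lambda>s. (indicator {a..b} s *\<^sub>R f s) \<bullet> (indicator {a..b} s *\<^sub>R g s))"
  proof (rule integrable_inner_bounded)
    show "integrable lborel (\<lambda>s. indicator {a..b} s *\<^sub>R f s)"
      using assms by (simp add: set_integrable_def)
    show "(\<lambda>s. indicator {a..b} s *\<^sub>R g s) \<in> borel_measurable lborel"
      using g by measurable
    show "norm (indicator {a..b} s *\<^sub>R g s) \<le> max B 0" for s
      using B[of "g s"] by (cases "s \<in> {a..b}") auto
  qed
  moreover have "(\<lambda>s. (indicator {a..b} s *\<^sub>R f s) \<bullet> (indicator {a..b} s *\<^sub>R g s)) = (\<lambda>s. indicator {a..b} s *\<^sub>R (f s * g s))"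
    by (auto simp: indicator_def fun_eq_iff)
  ultimately show ?thesis by (simp add: set_integrable_def)
qed

lemma continuous_on_edge_point: "continuous_on A (edge_point M e)"
  unfolding edge_point_def[abs_def] by (intro continuous_intros)

lemma weak_div_diff:
  assumes "bounded U" "open U" "weak_div U v d" "weak_div U w d'"
  shows "weak_div U (v - w) (d - d')"
  unfolding weak_div_def
proof (intro conjI ballI)
  show "L2 U (v - w)" "L2 U (d - d')" using assms L2_diff by (auto simp: weak_div_def)
  fix \<phi> assume \<phi>: "\<phi> \<in> test_functions U"
  then have sm: "smooth \<phi>" by (simp add: test_functions_def)
  have L2: "L2 U v" "L2 U w" "L2 U d" "L2 U d'" using assms by (auto simp: weak_div_def)
  have "integrable (lebesgue_on U) (\<lambda>x. f x \<bullet> grad \<phi> x)" if "L2 U f" for f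
    using L2_integrable_inner[OF that assms(1,2) smooth_continuous_on_grad[OF sm]] .
  moreover have "integrable (lebesgue_on U) (\<lambda>x. f x * \<phi> x)" if "L2 U f" for f :: "plane \<Rightarrow> real"
    using L2_integrable_inner[OF that assms(1,2) smooth_continuous_on[OF sm]] by simp
  ultimately show "(LINT x|lebesgue_on U. (v - w) x \<bullet> grad \<phi> x) = - (LINT x|lebesgue_on U. (d - d') x * \<phi> x)"
    using assms(3,4) \<phi> L2 by (simp add: weak_div_def inner_diff_left left_diff_distrib)
qed

text \<open>Green's formula is linear in the field, its divergence and its trace jointly. This
  concerns arbitrary representatives, not the ones selected by \<open>normal_trace\<close>.\<close>

lemma has_normal_trace_diff:
  assumes U: "bounded E" "open E"
    and v: "has_normal_trace M E v g" and w: "has_normal_trace M E w h"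
  shows "has_normal_trace M E (v - w) (\<lambda>e x. g e x - h e x)"
proof -
  obtain d where d: "weak_div E v d"
    and vd: "\<And>\<phi>. smooth \<phi> \<Longrightarrow> (LINT x|lebesgue_on E. v x \<bullet> grad \<phi> x) + (LINT x|lebesgue_on E. d x * \<phi> x) =
      (\<Sum>e\<in>edges M E. outward_sign M E e *
        (LINT s:edge_coords e|lborel. g e (edge_point M e s) * \<phi> (edge_point M e s)))"
    using v unfolding has_normal_trace_def by blast
  obtain d' where d': "weak_div E w d'"
    and wd: "\<And>\<phi>. smooth \<phi> \<Longrightarrow> (LINT x|lebesgue_on E. w x \<bullet> grad \<phi> x) + (LINT x|lebesgue_on E. d' x * \<phi> x) =
      (\<Sum>e\<in>edges M E. outward_sign M E e *
        (LINT s:edge_coords e|lborel. h e (edge_point M e s) * \<phi> (edge_point M e s)))"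
    using w unfolding has_normal_trace_def by blast
  have g: "set_integrable lborel (edge_coords e) (\<lambda>s. g e (edge_point M e s))"
    and h: "set_integrable lborel (edge_coords e) (\<lambda>s. h e (edge_point M e s))" if "e \<in> edges M E" for e
    using v w that by (auto simp: has_normal_trace_def)
  have green: "(LINT x|lebesgue_on E. (v - w) x \<bullet> grad \<phi> x) + (LINT x|lebesgue_on E. (d - d') x * \<phi> x) =
    (\<Sum>e\<in>edges M E. outward_sign M E e *
      (LINT s:edge_coords e|lborel. (g e (edge_point M e s) - h e (edge_point M e s)) * \<phi> (edge_point M e s)))"
    if sm: "smooth \<phi>" for \<phi>
  proof -
    have L2: "L2 E v" "L2 E w" "L2 E d" "L2 E d'" using d d' by (auto simp: weak_div_def)
    have 1: "integrable (lebesgue_on E) (\<lambda>x. f x \<bullet> grad \<phi> x)" if "L2 E f" for f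
      using L2_integrable_inner[OF that U smooth_continuous_on_grad[OF sm]] .
    have 2: "integrable (lebesgue_on E) (\<lambda>x. f x * \<phi> x)" if "L2 E f" for f :: "plane \<Rightarrow> real"
      using L2_integrable_inner[OF that U smooth_continuous_on[OF sm]] by simp
    have cont: "continuous_on UNIV (\<lambda>s. \<phi> (edge_point M e s))" for e
      by (rule continuous_on_compose2[OF smooth_continuous_on[OF sm, of UNIV] continuous_on_edge_point]) simp
    have edge: "(LINT s:edge_coords e|lborel. (g e (edge_point M e s) - h e (edge_point M e s)) * \<phi> (edge_point M e s))
       = (LINT s:edge_coords e|lborel. g e (edge_point M e s) * \<phi> (edge_point M e s))
       - (LINT s:edge_coords e|lborel. h e (edge_point M e s) * \<phi> (edge_point M e s))"
      if "e \<in> edges M E" for e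
      unfolding left_diff_distrib using g[OF that] h[OF that] cont
      by (intro set_integral_diff(2)) (auto simp: edge_coords_def intro: set_integrable_mult_continuous)
    have "(LINT x|lebesgue_on E. (v - w) x \<bullet> grad \<phi> x) + (LINT x|lebesgue_on E. (d - d') x * \<phi> x) =
       ((LINT x|lebesgue_on E. v x \<bullet> grad \<phi> x) + (LINT x|lebesgue_on E. d x * \<phi> x)) -
       ((LINT x|lebesgue_on E. w x \<bullet> grad \<phi> x) + (LINT x|lebesgue_on E. d' x * \<phi> x))"
      using 1 2 L2 by (simp add: inner_diff_left left_diff_distrib)
    also have "\<dots> = (\<Sum>e\<in>edges M E. outward_sign M E e *
        (LINT s:edge_coords e|lborel. (g e (edge_point M e s) - h e (edge_point M e s)) * \<phi> (edge_point M e s)))"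
      unfolding vd[OF sm] wd[OF sm] sum_subtractf[symmetric]
      by (intro sum.cong refl) (simp add: edge right_diff_distrib)
    finally show ?thesis .
  qed
  have "set_integrable lborel (edge_coords e) (\<lambda>s. g e (edge_point M e s) - h e (edge_point M e s))"
    if "e \<in> edges M E" for e
    by (rule set_integral_diff(1)[OF g[OF that] h[OF that]])
  moreover note weak_div_diff[OF U d d']
  ultimately show ?thesis using green unfolding has_normal_trace_def by (intro conjI ballI exI[of _ "d - d'"] allI impI) simp_all
qed

text \<open>Dominated convergence with dominating function \<open>B * \<bar>f x\<bar>\<close>. Bound
  and convergence are asked only where \<open>f\<close> is nonzero, so an indicator inside
  \<open>f\<close> restricts them to an edge.\<close>

lemma integral_mult_bounded_tendsto:
  fixes f \<psi>' :: "'a \<Rightarrow> real" and \<psi> :: "nat \<Rightarrow> 'a \<Rightarrow> real"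
  assumes f: "integrable M f" and \<psi>: "\<And>n. \<psi> n \<in> borel_measurable M"
    and bound: "\<And>n x. x \<in> space M \<Longrightarrow> f x \<noteq> 0 \<Longrightarrow> \<bar>\<psi> n x\<bar> \<le> B"
    and lim: "\<And>x. x \<in> space M \<Longrightarrow> f x \<noteq> 0 \<Longrightarrow> (\<lambda>n. \<psi> n x) \<longlonglongrightarrow> \<psi>' x"
  shows "(\<lambda>n. LINT x|M. f x * \<psi> n x) \<longlonglongrightarrow> (LINT x|M. f x * \<psi>' x)"
proof (rule integral_dominated_convergence)
  have fm: "f \<in> borel_measurable M" using f by simp
  show meas: "(\<lambda>x. f x * \<psi> n x) \<in> borel_measurable M" for n using fm \<psi> by simp
  have conv: "(\<lambda>n. f x * \<psi> n x) \<longlonglongrightarrow> f x * \<psi>' x" if "x \<in> space M" for x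
    using lim[OF that] by (cases "f x = 0") (auto intro: tendsto_mult_left)
  show "(\<lambda>x. f x * \<psi>' x) \<in> borel_measurable M"
    by (rule borel_measurable_LIMSEQ_real[OF conv meas])
  show "integrable M (\<lambda>x. B * \<bar>f x\<bar>)" using f by simp
  show "AE x in M. (\<lambda>n. f x * \<psi> n x) \<longlonglongrightarrow> f x * \<psi>' x" using conv by simp
  have "\<bar>f x * \<psi> n x\<bar> \<le> B * \<bar>f x\<bar>" if "x \<in> space M" for x n
    using mult_right_mono[OF bound[OF that], of "\<bar>f x\<bar>" n] by (cases "f x = 0") (auto simp: abs_mult mult.commute)
  then show "AE x in M. norm (f x * \<psi> n x) \<le> B * \<bar>f x\<bar>" for n by simp
qed

section \<open>Geometry of polygon edges\<close>

lemma diameter_closed_segment: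
  fixes a b :: "'a::euclidean_space"
  shows "diameter (closed_segment a b) = dist a b"
proof (rule antisym)
  show "diameter (closed_segment a b) \<le> dist a b"
  proof (rule diameter_le)
    fix x y assume "x \<in> closed_segment a b" "y \<in> closed_segment a b"
    then obtain u v where u: "0 \<le> u" "u \<le> 1" "x = (1 - u) *\<^sub>R a + u *\<^sub>R b"
      and v: "0 \<le> v" "v \<le> 1" "y = (1 - v) *\<^sub>R a + v *\<^sub>R b" by (auto simp: in_segment)
    have "x - y = (v - u) *\<^sub>R (a - b)" by (simp add: u v algebra_simps)
    moreover have "\<bar>v - u\<bar> * norm (a - b) \<le> 1 * norm (a - b)"
      using u v by (intro mult_right_mono) auto
    ultimately show "norm (x - y) \<le> dist a b" by (simp add: dist_norm)
  qed simp
  show "dist a b \<le> diameter (closed_segment a b)"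
    by (rule diameter_bounded_bound) (auto intro: compact_imp_bounded)
qed

text \<open>A segment determines its endpoints up to order, and \<open>midpoint\<close> is
  symmetric, so the description is unique.\<close>

lemma edge_midpoint_closed_segment: "edge_midpoint (closed_segment a b) = midpoint a b"
  unfolding edge_midpoint_def
  by (rule the_equality) (auto simp: doubleton_eq_iff midpoint_sym)

text \<open>In the plane the orthogonal complement of a unit vector is the line spanned by its
  rotation.\<close>

lemma eq_scaleR_perp:
  fixes u n :: plane
  assumes "norm n = 1" "n \<bullet> u = 0"
  shows "u = (u \<bullet> perp n) *\<^sub>R perp n"
proof -
  have n: "(n $ 1)\<^sup>2 + (n $ 2)\<^sup>2 = 1" using assms(1) by (simp add: norm_eq_1 inner_vec_def sum_2 power2_eq_square)
  have 0: "n $ 1 * u $ 1 + n $ 2 * u $ 2 = 0" using assms(2) by (simp add: inner_vec_def sum_2)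
  have "u $ 1 = (- u $ 1 * n $ 2 + u $ 2 * n $ 1) * - n $ 2"
       "u $ 2 = (- u $ 1 * n $ 2 + u $ 2 * n $ 1) * n $ 1" using n 0 by algebra+
  then show ?thesis by (simp add: vec_eq_iff forall_2 perp_def inner_vec_def sum_2)
qed

lemma norm_perp [simp]: "norm (perp a) = norm a"
  by (simp add: perp_def norm_eq_sqrt_inner inner_vec_def sum_2)

text \<open>The sign \<open>c\<close> records whether the rotated normal points from
  \<open>a\<close> to \<open>b\<close> or back, which the mesh leaves open.\<close>

lemma edge_point_closed_segment:
  assumes e: "e = closed_segment a b" and "a \<noteq> b"
    and n: "norm (normal M e) = 1" "normal M e \<bullet> (b - a) = 0"
  obtains c where "\<bar>c\<bar> = 1"
    "\<And>s. edge_point M e s = (1 - (1 / 2 + c * s / diameter e)) *\<^sub>R a + (1 / 2 + c * s / diameter e) *\<^sub>R b"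
proof -
  define c where "c = (b - a) \<bullet> perp (normal M e) / dist a b"
  have L: "diameter e = dist a b" "0 < dist a b" using assms by (simp_all add: diameter_closed_segment)
  have ba: "b - a = (c * dist a b) *\<^sub>R perp (normal M e)"
    using eq_scaleR_perp[OF n] L by (simp add: c_def)
  have "dist a b = \<bar>c\<bar> * dist a b"
    using arg_cong[OF ba, of norm] n L by (simp add: abs_mult dist_norm norm_minus_commute)
  then have c: "\<bar>c\<bar> = 1" using L by simp
  then have "c * c = 1" by (metis abs_mult_self_eq mult_1)
  then have perp: "perp (normal M e) = (c / dist a b) *\<^sub>R (b - a)"
    unfolding ba using L by simp
  have "edge_point M e s = (1 - (1 / 2 + c * s / diameter e)) *\<^sub>R a + (1 / 2 + c * s / diameter e) *\<^sub>R b" for s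
  proof -
    have "edge_midpoint e = midpoint a b" by (simp add: e edge_midpoint_closed_segment)
    moreover have "x = (1 / 2) *\<^sub>R x + (1 / 2) *\<^sub>R x" for x :: plane
      by (simp add: scaleR_add_left[symmetric])
    ultimately show ?thesis
      unfolding edge_point_def perp L(1) midpoint_def by (simp add: algebra_simps)
  qed
  with c show ?thesis by (rule that)
qed

lemma edge_point_in_closed_segment:
  assumes e: "e = closed_segment a b" and "a \<noteq> b"
    and n: "norm (normal M e) = 1" "normal M e \<bullet> (b - a) = 0"
  shows "s \<in> edge_coords e \<Longrightarrow> edge_point M e s \<in> e"
    and "s \<in> {- diameter e / 2<..<diameter e / 2} \<Longrightarrow> edge_point M e s \<in> open_segment a b"
proof -
  have L: "0 < diameter e" using assms by (simp add: diameter_closed_segment)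
  obtain c where c: "\<bar>c\<bar> = 1"
    and ep: "\<And>s. edge_point M e s = (1 - (1 / 2 + c * s / diameter e)) *\<^sub>R a + (1 / 2 + c * s / diameter e) *\<^sub>R b"
    using edge_point_closed_segment[OF assms] by blast
  have c': "c = 1 \<or> c = -1" using c by linarith
  show "edge_point M e s \<in> e" if "s \<in> edge_coords e"
  proof -
    have "0 \<le> 1 / 2 + c * s / diameter e" "1 / 2 + c * s / diameter e \<le> 1"
      using that L c' by (auto simp: edge_coords_def field_simps)
    then show ?thesis unfolding ep unfolding e in_segment by blast
  qed
  show "edge_point M e s \<in> open_segment a b" if "s \<in> {- diameter e / 2<..<diameter e / 2}"
  proof -
    have "0 < 1 / 2 + c * s / diameter e" "1 / 2 + c * s / diameter e < 1"
      using that L c' by (auto simp: field_simps)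
    then show ?thesis unfolding ep in_segment using \<open>a \<noteq> b\<close> by blast
  qed
qed

text \<open>Passes from the indices in \<open>simple_polygon\<close> to edges as sets: different
  edges have different indices, and distinct vertices make every edge nondegenerate.\<close>

lemma polygon_edge_Int_subset:
  assumes "simple_polygon vs" "e \<in> polygon_edges vs"
  obtains a b where "e = closed_segment a b" "a \<noteq> b"
    "\<And>e'. e' \<in> polygon_edges vs \<Longrightarrow> e' \<noteq> e \<Longrightarrow> e \<inter> e' \<subseteq> {a, b}"
proof -
  obtain i where i: "i < length vs" "e = polygon_edge vs i" using assms by (auto simp: polygon_edges_def)
  have vs: "3 \<le> length vs" "distinct vs" using assms by (auto simp: simple_polygon_def)
  have "Suc i mod length vs \<noteq> i" "Suc i mod length vs < length vs"
    using i vs by (auto simp: mod_Suc)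
  then have "vs ! i \<noteq> vs ! (Suc i mod length vs)" using i vs by (simp add: nth_eq_iff_index_eq)
  moreover have "e \<inter> e' \<subseteq> {vs ! i, vs ! (Suc i mod length vs)}"
    if e': "e' \<in> polygon_edges vs" "e' \<noteq> e" for e'
  proof -
    obtain j where j: "j < length vs" "e' = polygon_edge vs j" using e' by (auto simp: polygon_edges_def)
    then have "i \<noteq> j" using e' i by auto
    then show ?thesis using assms(1) i j unfolding simple_polygon_def by blast
  qed
  ultimately show ?thesis using that i by (auto simp: polygon_edge_def)
qed

section \<open>Uniqueness of normal traces\<close>

text \<open>Uniqueness is phrased through moments against continuous functions, the form in which
  the edge degrees of freedom use it.\<close>

lemma has_normal_trace_unique:
  assumes vs: "simple_polygon vs" "edges M E = polygon_edges vs"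
    and E: "E = inside (\<Union>(polygon_edges vs))" "bounded E" "open E"
    and normal: "\<And>e. e \<in> edges M E \<Longrightarrow> norm (normal M e) = 1 \<and> (\<forall>x\<in>e. \<forall>y\<in>e. normal M e \<bullet> (x - y) = 0)"
    and g: "has_normal_trace M E v g" and h: "has_normal_trace M E v h"
    and e: "e \<in> edges M E" and \<phi>: "continuous_on UNIV \<phi>"
  shows "(LINT s:edge_coords e|lborel. g e (edge_point M e s) * \<phi> (edge_point M e s)) =
    (LINT s:edge_coords e|lborel. h e (edge_point M e s) * \<phi> (edge_point M e s))"
proof -
  have fin: "finite (edges M E)" by (simp add: vs polygon_edges_def)
  have compact_edge: "compact e'" if "e' \<in> edges M E" for e'
    using that by (auto simp: vs polygon_edges_def polygon_edge_def)
  have ep_in: "edge_point M e' s \<in> e'" if "e' \<in> edges M E" "s \<in> edge_coords e'" for e' s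
  proof -
    have "e' \<in> polygon_edges vs" using that vs by simp
    from polygon_edge_Int_subset[OF vs(1) this] obtain a b where "e' = closed_segment a b" "a \<noteq> b" by metis
    then show ?thesis using edge_point_in_closed_segment(1)[of e' a b M s] normal[OF that(1)] that(2) by simp
  qed
  \<comment> \<open>A compact set containing every point at which Green's formula evaluates the test
    function; approximation has to be controlled only here.\<close>
  define K where "K = closure E \<union> \<Union>(edges M E)"
  have K: "compact K" using fin compact_edge E(2) unfolding K_def
    by (intro compact_Un compact_Union) (auto simp: compact_closure)
  have EK: "E \<subseteq> K" using closure_subset[of E] by (auto simp: K_def)
  have epK: "edge_point M e' s \<in> K" if "e' \<in> edges M E" "s \<in> edge_coords e'" for e' s
    using ep_in[OF that] that by (auto simp: K_def)

  \<comment> \<open>The field \<open>v - v\<close> is zero, so the gradient term drops out and only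
    the differences of divergences and of traces remain.\<close>
  have "has_normal_trace M E (v - v) (\<lambda>e x. g e x - h e x)"
    by (rule has_normal_trace_diff[OF E(2,3) g h])
  then obtain D where D: "weak_div E (v - v) D"
    and k: "\<And>e. e \<in> edges M E \<Longrightarrow> set_integrable lborel (edge_coords e) (\<lambda>s. g e (edge_point M e s) - h e (edge_point M e s))"
    and green: "\<And>\<psi>. smooth \<psi> \<Longrightarrow> (LINT x|lebesgue_on E. (v - v) x \<bullet> grad \<psi> x) + (LINT x|lebesgue_on E. D x * \<psi> x) =
      (\<Sum>e\<in>edges M E. outward_sign M E e * (LINT s:edge_coords e|lborel.
         (g e (edge_point M e s) - h e (edge_point M e s)) * \<psi> (edge_point M e s)))"
    unfolding has_normal_trace_def by blast
  define k where "k e' s = g e' (edge_point M e' s) - h e' (edge_point M e' s)" for e' s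
  define P where "P \<psi> \<longleftrightarrow> (LINT x|lebesgue_on E. D x * \<psi> x) =
      (\<Sum>e\<in>edges M E. outward_sign M E e * (LINT s:edge_coords e|lborel. k e s * \<psi> (edge_point M e s)))" for \<psi>
  have D_int: "integrable (lebesgue_on E) D"
    using D E by (intro L2_integrable) (auto simp: weak_div_def lmeasurable_open)

  \<comment> \<open>\<open>P\<close> survives bounded pointwise limits on \<open>K\<close>,
    including discontinuous ones; the isolation of a single edge relies on this.\<close>
  have P_limit: "P \<psi>'"
    if cont: "\<And>n. continuous_on UNIV (\<psi> n)" and P: "\<And>n. P (\<psi> n)"
      and bound: "\<And>n x. x \<in> K \<Longrightarrow> \<bar>\<psi> n x\<bar> \<le> B" and lim: "\<And>x. x \<in> K \<Longrightarrow> (\<lambda>n. \<psi> n x) \<longlonglongrightarrow> \<psi>' x"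
    for \<psi> :: "nat \<Rightarrow> plane \<Rightarrow> real" and \<psi>' B
  proof -
    have "(\<lambda>n. LINT x|lebesgue_on E. D x * \<psi> n x) \<longlonglongrightarrow> (LINT x|lebesgue_on E. D x * \<psi>' x)"
    proof (rule integral_mult_bounded_tendsto[OF D_int])
      show "\<psi> n \<in> borel_measurable (lebesgue_on E)" for n
        using E cont by (intro continuous_imp_measurable_on_sets_lebesgue) (auto intro: continuous_on_subset)
    qed (use bound lim EK in auto)
    moreover have "(\<lambda>n. LINT s:edge_coords e'|lborel. k e' s * \<psi> n (edge_point M e' s)) \<longlonglongrightarrow>
        (LINT s:edge_coords e'|lborel. k e' s * \<psi>' (edge_point M e' s))" if e': "e' \<in> edges M E" for e'
    proof -
      have "(\<lambda>n. LINT s|lborel. (indicator (edge_coords e') s *\<^sub>R k e' s) * \<psi> n (edge_point M e' s)) \<longlonglongrightarrow>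
        (LINT s|lborel. (indicator (edge_coords e') s *\<^sub>R k e' s) * \<psi>' (edge_point M e' s))"
      proof (rule integral_mult_bounded_tendsto)
        show "integrable lborel (\<lambda>s. indicator (edge_coords e') s *\<^sub>R k e' s)"
          using k[OF e'] by (simp add: set_integrable_def k_def)
        show "(\<lambda>s. \<psi> n (edge_point M e' s)) \<in> borel_measurable lborel" for n
          using continuous_on_compose2[OF cont continuous_on_edge_point[of UNIV M e']]
          by (auto intro: borel_measurable_continuous_onI)
      qed (use bound lim epK[OF e'] in \<open>auto simp: indicator_def split: if_splits\<close>)
      then show ?thesis by (simp add: set_lebesgue_integral_def mult.assoc)
    qed
    then have "(\<lambda>n. \<Sum>e'\<in>edges M E. outward_sign M E e' * (LINT s:edge_coords e'|lborel. k e' s * \<psi> n (edge_point M e' s)))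
       \<longlonglongrightarrow> (\<Sum>e'\<in>edges M E. outward_sign M E e' * (LINT s:edge_coords e'|lborel. k e' s * \<psi>' (edge_point M e' s)))"
      by (intro tendsto_sum tendsto_mult_left)
    ultimately show "P \<psi>'" using P unfolding P_def by (simp add: LIMSEQ_unique)
  qed

  have P_cont: "P \<psi>" if cont: "continuous_on UNIV \<psi>" for \<psi>
  proof -
    have "\<exists>p. real_polynomial_function p \<and> (\<forall>x\<in>K. \<bar>\<psi> x - p x\<bar> < inverse (real (Suc n)))" for n
      using Stone_Weierstrass_real_polynomial_function[OF K continuous_on_subset[OF cont, of K], of "inverse (real (Suc n))"]
      by (metis inverse_positive_iff_positive of_nat_0_less_iff subset_UNIV zero_less_Suc)
    then obtain p where p: "\<And>n. real_polynomial_function (p n)"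
      and close: "\<And>n x. x \<in> K \<Longrightarrow> \<bar>\<psi> x - p n x\<bar> < inverse (real (Suc n))" by metis
    have "compact (\<psi> ` K)"
      using K cont by (intro compact_continuous_image) (auto intro: continuous_on_subset)
    then have "bounded (\<psi> ` K)" by (rule compact_imp_bounded)
    then obtain B where B: "\<And>y. y \<in> \<psi> ` K \<Longrightarrow> norm y \<le> B" unfolding bounded_iff by blast
    show ?thesis
    proof (rule P_limit)
      show "continuous_on UNIV (p n)" for n
        using smooth_continuous_on[OF real_polynomial_function_smooth[OF p]] .
      show "P (p n)" for n
        using green[OF real_polynomial_function_smooth[OF p]] by (simp add: P_def k_def)
      show "\<bar>p n x\<bar> \<le> B + 1" if "x \<in> K" for n x
      proof -
        have "inverse (real (Suc n)) \<le> 1" by (simp add: inverse_le_1_iff)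
        then show ?thesis using close[OF that, of n] B[of "\<psi> x"] that by auto
      qed
      show "(\<lambda>n. p n x) \<longlonglongrightarrow> \<psi> x" if "x \<in> K" for x
      proof -
        have "(\<lambda>n. p n x - \<psi> x) \<longlonglongrightarrow> 0"
          by (rule Lim_null_comparison[OF _ LIMSEQ_inverse_real_of_nat])
            (use close[OF that] in \<open>auto intro!: always_eventually less_imp_le simp: abs_minus_commute\<close>)
        then show ?thesis by (simp add: LIM_zero_iff)
      qed
    qed
  qed

  have "e \<in> polygon_edges vs" using e vs by simp
  from polygon_edge_Int_subset[OF vs(1) this] obtain a b where ab: "e = closed_segment a b" "a \<noteq> b"
    and Int: "\<And>e'. e' \<in> polygon_edges vs \<Longrightarrow> e' \<noteq> e \<Longrightarrow> e \<inter> e' \<subseteq> {a, b}" by metis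
  have n: "norm (normal M e) = 1" "normal M e \<bullet> (b - a) = 0" using normal[OF e] by (auto simp: ab)
  \<comment> \<open>The set where the cutoff must vanish. The endpoints also keep it nonempty, as
    \<open>infdist\<close> to the empty set is 0.\<close>
  define F where "F = \<Union>(edges M E - {e}) \<union> {a, b}"
  have "closed (\<Union>(edges M E - {e}))"
    using fin compact_edge by (intro closed_Union) (auto intro: compact_imp_closed)
  then have F: "closed F" "F \<noteq> {}" by (auto simp: F_def)
  have e': "closed e" "e \<noteq> {}" by (simp_all add: ab)
  have openF: "open_segment a b \<inter> F = {}"
    using Int unfolding F_def vs(2) open_segment_def ab(1)[symmetric] by blast
  define \<psi>' where "\<psi>' x = (if x \<in> e \<and> x \<notin> F then \<phi> x else 0)" for x
  \<comment> \<open>The first factor tends to the indicator of \<open>e\<close>, the second to that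
    of the complement of \<open>F\<close>, and both stay in [0,1].\<close>
  define \<psi> where "\<psi> n x = max 0 (1 - real n * infdist x e) * min 1 (real n * infdist x F) * \<phi> x" for n x
  have "compact (\<phi> ` K)"
    using K \<phi> by (intro compact_continuous_image) (auto intro: continuous_on_subset)
  then have "bounded (\<phi> ` K)" by (rule compact_imp_bounded)
  then obtain B where B: "\<And>y. y \<in> \<phi> ` K \<Longrightarrow> norm y \<le> B" unfolding bounded_iff by blast
  have large: "\<forall>\<^sub>F n in sequentially. 1 \<le> real n * c" if "0 < c" for c
  proof -
    obtain N where "1 / c < real N" using reals_Archimedean2 by blast
    then have "1 \<le> real n * c" if "N \<le> n" for n
      using that \<open>0 < c\<close> by (smt (verit) of_nat_mono pos_divide_less_eq mult_right_mono)
    then show ?thesis by (auto simp: eventually_sequentially)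
  qed
  have "P \<psi>'"
  proof (rule P_limit)
    show cont: "continuous_on UNIV (\<psi> n)" for n
      unfolding \<psi>_def by (intro continuous_intros \<phi>)
    then show "P (\<psi> n)" for n by (rule P_cont)
    show "\<bar>\<psi> n x\<bar> \<le> B" if "x \<in> K" for n x
    proof -
      have 1: "\<bar>max 0 (1 - real n * infdist x e)\<bar> \<le> 1" "\<bar>min 1 (real n * infdist x F)\<bar> \<le> 1"
        using infdist_nonneg[of x e] infdist_nonneg[of x F]
        by (auto simp: abs_le_iff intro: mult_nonneg_nonneg order_trans[OF _ mult_nonneg_nonneg])
      have "\<bar>\<psi> n x\<bar> \<le> 1 * 1 * \<bar>\<phi> x\<bar>"
        unfolding \<psi>_def abs_mult by (intro mult_mono 1) auto
      then show ?thesis using B[of "\<phi> x"] that by auto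
    qed
    show "(\<lambda>n. \<psi> n x) \<longlonglongrightarrow> \<psi>' x" for x
    proof (rule tendsto_eventually)
      consider "x \<in> F" | "x \<notin> e" | "x \<in> e" "x \<notin> F" by blast
      then show "\<forall>\<^sub>F n in sequentially. \<psi> n x = \<psi>' x"
      proof cases
        case 1
        then show ?thesis by (simp add: \<psi>_def \<psi>'_def)
      next
        case 2
        then have "0 < infdist x e" using e' by (simp add: infdist_pos_not_in_closed)
        from large[OF this] show ?thesis
          by eventually_elim (use 2 in \<open>simp add: \<psi>_def \<psi>'_def\<close>)
      next
        case 3
        then have "0 < infdist x F" using F by (simp add: infdist_pos_not_in_closed)
        from large[OF this] show ?thesis
          by eventually_elim (use 3 in \<open>simp add: \<psi>_def \<psi>'_def\<close>)
      qed
    qed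
  qed
  moreover have "(LINT x|lebesgue_on E. D x * \<psi>' x) = 0"
  proof -
    \<comment> \<open>The limit lives on the edge \<open>e\<close>, and the inside of the polygon
      does not meet its edges.\<close>
    have "\<psi>' x = 0" if "x \<in> E" for x
    proof -
      have "x \<notin> \<Union>(polygon_edges vs)" using that inside_no_overlap[of "\<Union>(polygon_edges vs)"] E(1) by blast
      then show ?thesis using e vs by (auto simp: \<psi>'_def)
    qed
    then have "(LINT x|lebesgue_on E. D x * \<psi>' x) = (LINT x|lebesgue_on E. 0)"
      by (intro Bochner_Integration.integral_cong) auto
    then show ?thesis by simp
  qed
  moreover have "(LINT s:edge_coords e'|lborel. k e' s * \<psi>' (edge_point M e' s)) = 0"
    if "e' \<in> edges M E" "e' \<noteq> e" for e'
  proof -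
    have "\<psi>' (edge_point M e' s) = 0" if "s \<in> edge_coords e'" for s
      using ep_in[OF \<open>e' \<in> edges M E\<close> that] \<open>e' \<in> edges M E\<close> \<open>e' \<noteq> e\<close> by (auto simp: \<psi>'_def F_def)
    then have "indicator (edge_coords e') s *\<^sub>R (k e' s * \<psi>' (edge_point M e' s)) = 0" for s
      by (auto simp: indicator_def)
    then show ?thesis by (simp only: set_lebesgue_integral_def integral_zero)
  qed
  then have "(\<Sum>e'\<in>edges M E - {e}. outward_sign M E e' *
      (LINT s:edge_coords e'|lborel. k e' s * \<psi>' (edge_point M e' s))) = 0"
    by (intro sum.neutral) simp
  ultimately have "outward_sign M E e * (LINT s:edge_coords e|lborel. k e s * \<psi>' (edge_point M e s)) = 0"
    unfolding P_def by (simp add: sum.remove[OF fin e])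
  \<comment> \<open>The factor \<open>outward_sign M E e\<close> is 1 or -1 and can be
    cancelled.\<close>
  then have "(LINT s:edge_coords e|lborel. k e s * \<psi>' (edge_point M e s)) = 0"
    by (simp add: outward_sign_def split: if_splits)
  also have "(LINT s:edge_coords e|lborel. k e s * \<psi>' (edge_point M e s)) =
      (LINT s:edge_coords e|lborel. k e s * \<phi> (edge_point M e s))"
    unfolding set_lebesgue_integral_def
  \<comment> \<open>Along \<open>e\<close> the limit differs from \<open>\<phi>\<close> at most at
    the two endpoints, a null set of parameters.\<close>
  proof (rule integral_discrete_difference[of "{- diameter e / 2, diameter e / 2}"])
    fix s assume s: "s \<notin> {- diameter e / 2, diameter e / 2}"
    show "indicator (edge_coords e) s *\<^sub>R (k e s * \<psi>' (edge_point M e s)) =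
        indicator (edge_coords e) s *\<^sub>R (k e s * \<phi> (edge_point M e s))"
    proof (cases "s \<in> edge_coords e")
      case True
      then have "s \<in> {- diameter e / 2<..<diameter e / 2}" using s by (auto simp: edge_coords_def)
      from edge_point_in_closed_segment(2)[OF ab n this] have "\<psi>' (edge_point M e s) = \<phi> (edge_point M e s)"
        using openF ep_in[OF e True] by (auto simp: \<psi>'_def)
      then show ?thesis by simp
    qed simp
  qed auto
  finally have zero: "(LINT s:edge_coords e|lborel. k e s * \<phi> (edge_point M e s)) = 0" .
  have "continuous_on UNIV (\<lambda>s. \<phi> (edge_point M e s))"
    by (rule continuous_on_compose2[OF \<phi> continuous_on_edge_point]) simp
  then have int: "set_integrable lborel (edge_coords e) (\<lambda>s. f e (edge_point M e s) * \<phi> (edge_point M e s))"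
    if "has_normal_trace M E v f" for f
    using that e unfolding has_normal_trace_def edge_coords_def by (intro set_integrable_mult_continuous) auto
  have "(LINT s:edge_coords e|lborel. k e s * \<phi> (edge_point M e s)) =
      (LINT s:edge_coords e|lborel. g e (edge_point M e s) * \<phi> (edge_point M e s)) -
      (LINT s:edge_coords e|lborel. h e (edge_point M e s) * \<phi> (edge_point M e s))"
    unfolding k_def left_diff_distrib by (rule set_integral_diff(2)[OF int[OF g] int[OF h]])
  then show ?thesis using zero by simp
qed

text \<open>The area moments are linear by linearity of the integral. The edge moments involve a
  trace picked by \<open>SOME\<close>, so their linearity rests on uniqueness.\<close>

lemma dof_diff:
  assumes mesh: "regular_mesh \<Omega> \<rho> M" "E \<in> elements M"
    and w: "w \<in> V_local M k E" and z: "z \<in> V_local M k E" and i: "i \<in> dof_indices M k E"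
  shows "dof M E (w - z) i = dof M E w i - dof M E z i"
proof -
  have "\<exists>vs. simple_polygon vs \<and> edges M E = polygon_edges vs \<and> E = inside (\<Union>(polygon_edges vs))"
    using mesh unfolding regular_mesh_def by blast
  then obtain vs where vs: "simple_polygon vs" "edges M E = polygon_edges vs" "E = inside (\<Union>(polygon_edges vs))"
    by blast
  have normal: "norm (normal M e) = 1 \<and> (\<forall>x\<in>e. \<forall>y\<in>e. normal M e \<bullet> (x - y) = 0)" if "e \<in> edges M E" for e
    using mesh that unfolding regular_mesh_def by blast
  have "compact (\<Union>(polygon_edges vs))"
    by (intro compact_Union) (auto simp: polygon_edges_def polygon_edge_def)
  then have E: "bounded E" "open E"
    unfolding vs(3) by (auto intro: bounded_inside compact_imp_bounded open_inside compact_imp_closed)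
  have L2: "L2 E w" "L2 E z" using w z by (auto simp: V_local_def H_div_def weak_div_def)
  have linear: "(LINT x|lebesgue_on E. (w - z) x \<bullet> f x) = (LINT x|lebesgue_on E. w x \<bullet> f x) - (LINT x|lebesgue_on E. z x \<bullet> f x)"
    if "continuous_on UNIV f" for f
    using L2_integrable_inner[OF L2(1) E that] L2_integrable_inner[OF L2(2) E that]
    by (simp add: inner_diff_left)
  have mono: "smooth (scaled_monomial E \<alpha>)" for \<alpha>
    by (intro real_polynomial_function_smooth real_polynomial_function_scaled_monomial)
  show ?thesis
  proof (cases i)
    case (Edge_Dof e a)
    then have e: "e \<in> edges M E" using i by (auto simp: dof_indices_def)
    have tw: "has_normal_trace M E w (normal_trace M E w)" and tz: "has_normal_trace M E z (normal_trace M E z)"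
      unfolding normal_trace_def using w z someI_ex[of "has_normal_trace M E _"] by (auto simp: V_local_def)
    \<comment> \<open>The difference of the chosen traces is some trace of \<open>w - z\<close>.
      Hence the chosen one is a trace too, and uniqueness compares the two.\<close>
    note diff = has_normal_trace_diff[OF E tw tz]
    then have td: "has_normal_trace M E (w - z) (normal_trace M E (w - z))"
      unfolding normal_trace_def by (rule someI[of "has_normal_trace M E (w - z)"])
    \<comment> \<open>Extends the edge monomial to a continuous function on the plane, as the
      uniqueness lemma requires.\<close>
    define \<phi> where "\<phi> x = ((x - edge_midpoint e) \<bullet> perp (normal M e) / diameter e) ^ a" for x
    have \<phi>: "continuous_on UNIV \<phi>" unfolding \<phi>_def[abs_def] divide_inverse by (intro continuous_intros)
    have "perp (normal M e) \<bullet> perp (normal M e) = 1"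
      using normal[OF e] by (simp add: dot_square_norm)
    then have \<phi>_ep: "\<phi> (edge_point M e s) = (s / diameter e) ^ a" for s
      by (simp add: \<phi>_def edge_point_def)
    have "continuous_on UNIV (\<lambda>s. (s / diameter e) ^ a)" unfolding divide_inverse by (intro continuous_intros)
    then have int: "set_integrable lborel (edge_coords e) (\<lambda>s. g e (edge_point M e s) * (s / diameter e) ^ a)"
      if "has_normal_trace M E v g" for v g
      using that e unfolding has_normal_trace_def edge_coords_def by (intro set_integrable_mult_continuous) auto
    have "(LINT s:edge_coords e|lborel. normal_trace M E (w - z) e (edge_point M e s) * (s / diameter e) ^ a) =
       (LINT s:edge_coords e|lborel. (normal_trace M E w e (edge_point M e s) - normal_trace M E z e (edge_point M e s)) * (s / diameter e) ^ a)"
      using has_normal_trace_unique[OF vs(1,2,3) E normal td diff e \<phi>] by (simp add: \<phi>_ep)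
    also have "\<dots> = (LINT s:edge_coords e|lborel. normal_trace M E w e (edge_point M e s) * (s / diameter e) ^ a)
      - (LINT s:edge_coords e|lborel. normal_trace M E z e (edge_point M e s) * (s / diameter e) ^ a)"
      unfolding left_diff_distrib by (rule set_integral_diff(2)[OF int[OF tw] int[OF tz]])
    finally show ?thesis by (simp add: Edge_Dof right_diff_distrib diff_divide_distrib)
  next
    case (Grad_Dof \<alpha>)
    show ?thesis
      using linear[OF smooth_continuous_on_grad[OF mono]]
      by (simp add: Grad_Dof right_diff_distrib diff_divide_distrib)
  next
    case (Perp_Dof \<alpha>)
    \<comment> \<open>Moving the scalar weight into the vector field gives this moment the form
      covered by \<open>linear\<close>.\<close>
    define f where "f x = scaled_monomial E \<alpha> x *\<^sub>R perp ((1 / diameter E) *\<^sub>R (x - barycenter E))" for x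
    have "continuous_on UNIV f"
      unfolding f_def by (intro continuous_intros smooth_continuous_on mono)
    moreover have "(v x \<bullet> perp ((1 / diameter E) *\<^sub>R (x - barycenter E))) * scaled_monomial E \<alpha> x = v x \<bullet> f x" for v x
      by (simp add: f_def mult.commute)
    ultimately show ?thesis
      using linear[of f] by (simp only: Perp_Dof dof.simps right_diff_distrib)
  qed
qed

section \<open>Assembly of the estimate\<close>

theorem lemma30:
  fixes p :: real
  assumes "1 < p"
  shows "\<exists>C>0. \<forall>\<Omega> (k :: nat) \<rho> M w z.
    polygonal_domain \<Omega> \<longrightarrow> \<rho> > 0 \<longrightarrow> regular_mesh \<Omega> \<rho> M \<longrightarrow>
    w \<in> V_global \<Omega> M k \<longrightarrow> z \<in> V_global \<Omega> M k \<longrightarrow>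
    (\<Sum>E\<in>elements M. stab p M k E w (w - z) - stab p M k E z (w - z))
      \<ge> C * rpow (\<Sum>E\<in>elements M. stab p M k E w w + stab p M k E z z)
                  ((min (conj_exp p) 2 - 2) / conj_exp p)
          * rpow (\<Sum>E\<in>elements M. stab p M k E (w - z) (w - z))
                  (max (conj_exp p) 2 / conj_exp p)"
proof -
  define r where "r = conj_exp p"
  have r: "1 < r" using assms by (simp add: r_def conj_exp_def)
  \<comment> \<open>The constant of \<open>sum_power_gap_ge\<close>, fixed from \<open>p\<close>
    alone before domain, mesh and degree are introduced.\<close>
  define C where "C = (if r < 2 then (r - 1) * 2 powr (r - 2) else 2 powr (1 - r))"
  have "0 < C" using r by (simp add: C_def)
  have self: "stab p M k E v v = (diameter E)\<^sup>2 * L2_set (dof M E v) (dof_indices M k E) powr r" for M k E v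
  proof -
    have "(\<Sum>i\<in>dof_indices M k E. dof M E v i * dof M E v i) = (L2_set (dof M E v) (dof_indices M k E))\<^sup>2"
      by (simp add: L2_set_def sum_nonneg power2_eq_square)
    moreover have "x powr (r - 2) * x\<^sup>2 = x powr r" if "0 \<le> x" for x :: real
      using that by (cases "x = 0") (simp_all add: powr_diff powr_numeral)
    ultimately show ?thesis
      unfolding stab_def r_def[symmetric] by (simp add: mult.assoc L2_set_nonneg)
  qed
  show ?thesis
  proof (intro exI[of _ C] conjI allI impI)
    fix \<Omega> \<rho> M w z and k :: nat
    assume mesh: "regular_mesh \<Omega> \<rho> M" and w: "w \<in> V_global \<Omega> M k" and z: "z \<in> V_global \<Omega> M k"
    define a where "a E = L2_set (dof M E w) (dof_indices M k E)" for E
    define b where "b E = L2_set (dof M E z) (dof_indices M k E)" for E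
    define d where "d E = L2_set (dof M E (w - z)) (dof_indices M k E)" for E
    define t where "t E = (\<Sum>i\<in>dof_indices M k E. dof M E w i * dof M E z i)" for E
    have sq: "(L2_set f A)\<^sup>2 = (\<Sum>i\<in>A. (f i)\<^sup>2)" for f and A :: "dof_index set"
      by (simp add: L2_set_def sum_nonneg)
    \<comment> \<open>This linearity reduces the rest to norms and inner products: \<open>d2\<close>
      expands the square of a difference and \<open>t\<close> is Cauchy-Schwarz.\<close>
    have diff: "dof M E (w - z) i = dof M E w i - dof M E z i"
      if "E \<in> elements M" "i \<in> dof_indices M k E" for E i
      using dof_diff[OF mesh that(1) _ _ that(2)] w z that(1) by (auto simp: V_global_def)
    have d2: "(d E)\<^sup>2 = (a E)\<^sup>2 + (b E)\<^sup>2 - 2 * t E" if "E \<in> elements M" for E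
      unfolding a_def b_def d_def t_def sq sum_distrib_left sum.distrib[symmetric] sum_subtractf[symmetric]
      by (intro sum.cong refl) (simp add: diff[OF that] power2_diff)
    have t: "\<bar>t E\<bar> \<le> a E * b E" for E
      unfolding t_def a_def b_def
      by (rule order_trans[OF sum_abs]) (simp add: abs_mult L2_set_mult_ineq)
    have gap: "stab p M k E w (w - z) - stab p M k E z (w - z) =
        (diameter E)\<^sup>2 * (a E powr (r - 2) * ((a E)\<^sup>2 - t E) - b E powr (r - 2) * (t E - (b E)\<^sup>2))"
      if "E \<in> elements M" for E
    proof -
      have "(\<Sum>i\<in>dof_indices M k E. dof M E w i * dof M E (w - z) i) = (a E)\<^sup>2 - t E"
        "(\<Sum>i\<in>dof_indices M k E. dof M E z i * dof M E (w - z) i) = t E - (b E)\<^sup>2"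
        unfolding a_def b_def t_def sq sum_subtractf[symmetric]
        by (auto intro!: sum.cong simp: diff[OF that] power2_eq_square algebra_simps)
      then show ?thesis
        unfolding stab_def r_def[symmetric] a_def[symmetric] b_def[symmetric]
        by (simp only: right_diff_distrib mult.assoc)
    qed
    have "finite (elements M)" using mesh by (simp add: regular_mesh_def)
    from sum_power_gap_ge[OF this r, of "\<lambda>E. (diameter E)\<^sup>2" a b d t] t d2
    have "C * rpow (\<Sum>E\<in>elements M. (diameter E)\<^sup>2 * (a E powr r + b E powr r)) ((min r 2 - 2) / r)
          * rpow (\<Sum>E\<in>elements M. (diameter E)\<^sup>2 * d E powr r) (max r 2 / r)
        \<le> (\<Sum>E\<in>elements M. (diameter E)\<^sup>2 *
             (a E powr (r - 2) * ((a E)\<^sup>2 - t E) - b E powr (r - 2) * (t E - (b E)\<^sup>2)))"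
      by (simp add: C_def a_def b_def d_def L2_set_nonneg)
    then show "(\<Sum>E\<in>elements M. stab p M k E w (w - z) - stab p M k E z (w - z))
      \<ge> C * rpow (\<Sum>E\<in>elements M. stab p M k E w w + stab p M k E z z) ((min (conj_exp p) 2 - 2) / conj_exp p)
          * rpow (\<Sum>E\<in>elements M. stab p M k E (w - z) (w - z)) (max (conj_exp p) 2 / conj_exp p)"
      by (simp add: gap self a_def b_def d_def r_def[symmetric] distrib_left)
  qed (rule \<open>0 < C\<close>)
qed

end
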